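(* Let $(X,\mu)$ and $(Y,\nu)$ be $\sigma$-finite measure spaces, let $1<p<\infty$ and let $T\colon L^p(X,\mu)\to L^p(Y,\nu)$ be a kernel operator with strictly positive integral kernel. Then there exists a strictly positive $h\in L^0(X,\mu)$ such that $$T^*(Th)^{p-1}\le\lambda(T)\,h^{p-1}\quad\mu\text{-a.e.}$$
   Context: $L^0(X,\mu)$ denotes a.e.-classes of measurable real-valued functions, $L^+(X,\mu)$ a.e.-classes of measurable functions $X\to[0,\infty]$, $L^p_+$ the nonnegative elements of $L^p$; strictly positive means $>0$ a.e. $T$ is a kernel operator with strictly positive integral kernel if it is linear and there is a jointly measurable $k\colon Y\times X\to(0,\infty)$ with $Tf(y)=\int_Xk(y,x)f(x)\,d\mu(x)$ for $\nu$-a.e. $y$ and all $f\in L^p(X,\mu)$; such $T$ is positivity preserving and hence bounded. With $1/p+1/q=1$, $T^*\colon L^q(Y,\nu)\to L^q(X,\mu)$ is the adjoint. A positivity preserving operator $S$ is extended to $[0,\infty]$-valued functions by $Sf=\lim_nSf_n$ for any nonnegative $f_n$ in the original $L^p$-space with $f_n\nearrow f$ a.e.; in this sense $T^*(Th)^{p-1}$ (meaning $T^*$ applied to $(Th)^{p-1}$) is defined for all $h\in L^+(X,\mu)$, with $\infty^{p-1}=\infty$. Finally, $$\lambda(T)=\inf\{\lambda\ge0\mid\text{there is a strictly positive }f\in L^p_+(X,\mu)\text{ with }T^*(Tf)^{p-1}\le\lambda f^{p-1}\}.$$ *)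

theory Defs
  imports "HOL-Analysis.Analysis"
begin

text \<open>Elements of \<open>L\<^sup>p\<close> are represented by measurable functions; the identification of a.e. equal
  functions is made through a.e. statements throughout.\<close>

definition Lp :: "'a measure \<Rightarrow> real \<Rightarrow> ('a \<Rightarrow> real) set" where
  "Lp M p = {f \<in> borel_measurable M. integrable M (\<lambda>x. \<bar>f x\<bar> powr p)}"

definition Lp_linear :: "'a measure \<Rightarrow> 'b measure \<Rightarrow> real \<Rightarrow> (('a \<Rightarrow> real) \<Rightarrow> ('b \<Rightarrow> real)) \<Rightarrow> bool" where
  "Lp_linear M N p T \<longleftrightarrow>
     (\<forall>f\<in>Lp M p. T f \<in> Lp N p) \<and>
     (\<forall>f\<in>Lp M p. \<forall>g\<in>Lp M p. (AE x in M. f x = g x) \<longrightarrow> (AE y in N. T f y = T g y)) \<and>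
     (\<forall>f\<in>Lp M p. \<forall>g\<in>Lp M p. AE y in N. T (\<lambda>x. f x + g x) y = T f y + T g y) \<and>
     (\<forall>f\<in>Lp M p. \<forall>c. AE y in N. T (\<lambda>x. c * f x) y = c * T f y)"

text \<open>Integrability of the integrand is required explicitly, because the Bochner integral of a
  non-integrable function is \<open>0\<close> by convention.\<close>

definition positive_kernel_operator ::
    "'a measure \<Rightarrow> 'b measure \<Rightarrow> real \<Rightarrow> (('a \<Rightarrow> real) \<Rightarrow> ('b \<Rightarrow> real)) \<Rightarrow> bool" where
  "positive_kernel_operator M N p T \<longleftrightarrow>
     Lp_linear M N p T \<and>
     (\<exists>k :: 'b \<times> 'a \<Rightarrow> real.
        k \<in> borel_measurable (N \<Otimes>\<^sub>M M) \<and>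
        (\<forall>y\<in>space N. \<forall>x\<in>space M. 0 < k (y, x)) \<and>
        (\<forall>f\<in>Lp M p. AE y in N. integrable M (\<lambda>x. k (y, x) * f x) \<and>
                               T f y = (\<integral>x. k (y, x) * f x \<partial>M)))"

text \<open>The adjoint \<open>L\<^sup>q(N) \<rightarrow> L\<^sup>q(M)\<close> of a bounded operator \<open>T : L\<^sup>p(M) \<rightarrow> L\<^sup>p(N)\<close>, where
  \<open>1/p + 1/q = 1\<close>. Over \<open>\<sigma>\<close>-finite measures the chosen representative is unique a.e.\<close>

definition Lp_adjoint ::
    "'a measure \<Rightarrow> 'b measure \<Rightarrow> real \<Rightarrow> real \<Rightarrow> (('a \<Rightarrow> real) \<Rightarrow> ('b \<Rightarrow> real)) \<Rightarrow>
      ('b \<Rightarrow> real) \<Rightarrow> ('a \<Rightarrow> real)" where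
  "Lp_adjoint M N p q T g =
     (SOME u. u \<in> Lp M q \<and> (\<forall>f\<in>Lp M p. (\<integral>x. f x * u x \<partial>M) = (\<integral>y. T f y * g y \<partial>N)))"

definition Lp_approx :: "'a measure \<Rightarrow> real \<Rightarrow> (nat \<Rightarrow> 'a \<Rightarrow> real) \<Rightarrow> ('a \<Rightarrow> ennreal) \<Rightarrow> bool" where
  "Lp_approx M p F f \<longleftrightarrow>
     (\<forall>n. F n \<in> Lp M p \<and> (AE x in M. 0 \<le> F n x)) \<and>
     (AE x in M. incseq (\<lambda>n. F n x) \<and> (\<lambda>n. ennreal (F n x)) \<longlonglongrightarrow> f x)"

text \<open>The extension of a positivity preserving operator \<open>S\<close> on \<open>L\<^sup>p(M)\<close> to \<open>[0,\<infinity>]\<close>-valued functions: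
  \<open>S f\<close> is the a.e. limit of \<open>S F\<^sub>n\<close> for any sequence \<open>0 \<le> F\<^sub>n \<nearrow> f\<close> in \<open>L\<^sup>p(M)\<close>. Over a \<open>\<sigma>\<close>-finite
  measure such sequences exist for every measurable \<open>f\<close>, so the limit is determined a.e.\<close>

definition pos_extension ::
    "'a measure \<Rightarrow> 'b measure \<Rightarrow> real \<Rightarrow> (('a \<Rightarrow> real) \<Rightarrow> ('b \<Rightarrow> real)) \<Rightarrow>
      ('a \<Rightarrow> ennreal) \<Rightarrow> ('b \<Rightarrow> ennreal)" where
  "pos_extension M N p S f =
     (SOME g. g \<in> borel_measurable N \<and>
        (\<forall>F. Lp_approx M p F f \<longrightarrow> (AE y in N. (\<lambda>n. ennreal (S (F n) y)) \<longlonglongrightarrow> g y)))"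

definition ennreal_powr :: "ennreal \<Rightarrow> real \<Rightarrow> ennreal" where
  "ennreal_powr a r = (if a = \<infinity> then \<infinity> else ennreal (enn2real a powr r))"

text \<open>The infimum is taken in \<open>[0,\<infinity>]\<close>, so that it would be \<open>\<infinity>\<close> (rather than unspecified) on the
  empty set. For \<open>f \<ge> 0\<close> the function \<open>(T f)\<^bsup>p-1\<^esup>\<close> lies in \<open>L\<^sup>q(N)\<close>, so no extension is needed here.\<close>

definition lambda_op ::
    "'a measure \<Rightarrow> 'b measure \<Rightarrow> real \<Rightarrow> real \<Rightarrow> (('a \<Rightarrow> real) \<Rightarrow> ('b \<Rightarrow> real)) \<Rightarrow> ennreal" where
  "lambda_op M N p q T =
     Inf {ennreal c | c. 0 \<le> c \<and>
       (\<exists>f\<in>Lp M p. (AE x in M. 0 < f x) \<and>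
          (AE x in M. Lp_adjoint M N p q T (\<lambda>y. T f y powr (p - 1)) x \<le> c * f x powr (p - 1)))}"

end

theory Submission
  imports Defs
begin

text \<open>Write \<open>r = p - 1\<close> and \<open>\<Phi> f = T\<^sup>*(Tf)\<^sup>r\<close>, and choose strictly positive \<open>f\<^sub>n\<close> in \<open>L\<^sup>p\<close> with
  \<open>\<Phi> f\<^sub>n \<le> c\<^sub>n f\<^sub>n\<^sup>r\<close> and \<open>c\<^sub>n \<rightarrow> \<lambda>(T)\<close>. Two applications of Fatou's lemma give
  \<open>\<Phi> (liminf f\<^sub>n) \<le> liminf \<Phi> f\<^sub>n \<le> \<lambda>(T) (liminf f\<^sub>n)\<^sup>r\<close>, so no compactness is needed, only a normalisation
  for which \<open>h = liminf f\<^sub>n\<close> is neither \<open>0\<close> nor \<open>\<infinity>\<close>. Normalise by \<open>\<integral>\<^sub>A f\<^sub>n = 1\<close>, where \<open>A\<close> has finite positive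
  measure and \<open>\<integral> b(y) min(k(y,x),1) dy \<ge> \<delta>\<close> for \<open>x \<in> A\<close>, for a fixed integrable \<open>b > 0\<close>. Then the functions
  \<open>F\<^sub>n(y) = \<integral>\<^sub>A min(k(y,x),1) f\<^sub>n(x) dx \<le> 1\<close> satisfy \<open>\<integral> b F\<^sub>n \<ge> \<delta>\<close>, so they cannot tend to \<open>0\<close> and, \<open>k\<close> being
  positive, \<open>\<Phi> f\<^sub>n(x) \<ge> \<integral> k(y,x) F\<^sub>n(y)\<^sup>r dy\<close> is bounded below uniformly in \<open>n\<close>; hence \<open>h > 0\<close>. Conversely
  \<open>h < \<infinity>\<close> a.e. on \<open>A\<close> by Fatou, so \<open>\<Phi> h\<close> is finite somewhere, which forces \<open>Th < \<infinity>\<close> a.e. and then \<open>h < \<infinity>\<close>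
  a.e.\<close>

subsection \<open>Powers of extended nonnegative reals\<close>

lemma ennreal_powr_top [simp]: "ennreal_powr top r = top"
  by (simp add: ennreal_powr_def)

lemma ennreal_powr_ennreal: "0 \<le> x \<Longrightarrow> ennreal_powr (ennreal x) r = ennreal (x powr r)"
  by (simp add: ennreal_powr_def)

lemma ennreal_powr_mono:
  assumes "0 \<le> r" "a \<le> b"
  shows "ennreal_powr a r \<le> ennreal_powr b r"
  using assms
  by (cases a; cases b) (auto simp: ennreal_powr_ennreal top_unique intro!: ennreal_leI powr_mono2)

lemma ennreal_powr_mult:
  assumes "0 < r"
  shows "ennreal_powr (a * b) r = ennreal_powr a r * ennreal_powr b r"
proof (cases a)
  case (real x)
  show ?thesis
  proof (cases b)
    case (real y)
    then show ?thesis using \<open>a = ennreal x\<close> \<open>0 \<le> x\<close>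
      by (simp add: ennreal_powr_ennreal powr_mult flip: ennreal_mult)
  next
    case top
    then show ?thesis using real assms
      by (cases "x = 0") (simp_all add: ennreal_powr_ennreal ennreal_mult_top, simp add: ennreal_powr_def)
  qed
next
  case top
  show ?thesis
    using assms top by (cases b) (auto simp: ennreal_powr_ennreal ennreal_top_mult ennreal_powr_def)
qed

lemma ennreal_powr_powr:
  assumes "0 < r"
  shows "ennreal_powr (ennreal_powr a r) (1 / r) = a"
  using assms by (cases a) (auto simp: ennreal_powr_ennreal powr_powr)

lemma ennreal_powr_zero [simp]: "ennreal_powr 0 r = 0"
  by (simp add: ennreal_powr_def)

text \<open>A monotone map with open range is continuous, and the power \<open>1 / r\<close> shows
  that this one is onto.\<close>

lemma continuous_ennreal_powr:
  assumes "0 < r"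
  shows "continuous_on UNIV (\<lambda>a. ennreal_powr a r)"
proof (rule continuous_onI_mono)
  have "b \<in> range (\<lambda>a. ennreal_powr a r)" for b
    using ennreal_powr_powr[of "1/r" b] assms by (intro image_eqI[of _ _ "ennreal_powr b (1/r)"]) auto
  then have "range (\<lambda>a. ennreal_powr a r) = UNIV"
    by blast
  then show "open (range (\<lambda>a. ennreal_powr a r))"
    by simp
qed (use assms in \<open>auto intro: ennreal_powr_mono\<close>)

lemma borel_measurable_ennreal_powr [measurable (raw)]:
  assumes "f \<in> borel_measurable M"
  shows "(\<lambda>x. ennreal_powr (f x) r) \<in> borel_measurable M"
  unfolding ennreal_powr_def using assms by measurable

lemma liminf_ennreal_powr:
  fixes a :: "nat \<Rightarrow> ennreal"
  assumes "0 < r"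
  shows "liminf (\<lambda>n. ennreal_powr (a n) r) = ennreal_powr (liminf a) r"
  by (rule Liminf_compose_continuous_mono[OF continuous_ennreal_powr[OF assms]])
    (use assms in \<open>auto intro!: monoI ennreal_powr_mono\<close>)

text \<open>Along a subsequence realising the liminf of \<open>a\<close> both factors converge.
  Finiteness of both limits excludes \<open>0 * \<infinity>\<close>, where multiplication is not
  continuous.\<close>

lemma liminf_mult_le:
  fixes c a :: "nat \<Rightarrow> ennreal"
  assumes "c \<longlonglongrightarrow> L" "L < \<infinity>" "liminf a < \<infinity>"
  shows "liminf (\<lambda>n. c n * a n) \<le> L * liminf a"
proof -
  obtain s where s: "strict_mono s" "(a \<circ> s) \<longlonglongrightarrow> liminf a"
    using liminf_subseq_lim by blast
  have "(c \<circ> s) \<longlonglongrightarrow> L"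
    using assms(1) s(1) by (rule LIMSEQ_subseq_LIMSEQ)
  then have "(\<lambda>n. (c \<circ> s) n * (a \<circ> s) n) \<longlonglongrightarrow> L * liminf a"
    using s(2) by (rule tendsto_mult_ennreal) (use assms in auto)
  then have "liminf (\<lambda>n. (c \<circ> s) n * (a \<circ> s) n) = L * liminf a"
    by (simp add: lim_imp_Liminf)
  moreover have "liminf (\<lambda>n. c n * a n) \<le> liminf ((\<lambda>n. c n * a n) \<circ> s)"
    by (rule liminf_subseq_mono[OF s(1)])
  ultimately show ?thesis
    by (simp add: comp_def)
qed

subsection \<open>Integral operators with positive kernel\<close>

text \<open>If \<open>F \<le> 1\<close> has \<open>b\<close>-mass at least \<open>\<delta>\<close>,
  it cannot be small outside a set of small \<open>b\<close>-mass, and off such a set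
  \<open>\<kappa>\<close> dominates a multiple of \<open>b\<close>. The point is that
  \<open>c\<close> does not depend on \<open>F\<close>; this takes the place of a compactness
  argument.\<close>

lemma exists_kernel_lower_bound:
  fixes b \<kappa> :: "'b \<Rightarrow> ennreal"
  assumes [measurable]: "b \<in> borel_measurable N" "\<kappa> \<in> borel_measurable N"
    and b: "(\<integral>\<^sup>+y. b y \<partial>N) < \<infinity>" "\<And>y. y \<in> space N \<Longrightarrow> b y < \<infinity>"
    and \<kappa>: "\<And>y. y \<in> space N \<Longrightarrow> 0 < \<kappa> y"
    and "0 < \<delta>" "0 < r"
  shows "\<exists>c>0. \<forall>F\<in>borel_measurable N. (\<forall>y\<in>space N. F y \<le> 1) \<longrightarrow> \<delta> \<le> (\<integral>\<^sup>+y. b y * F y \<partial>N) \<longrightarrow>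
           c \<le> (\<integral>\<^sup>+y. \<kappa> y * ennreal_powr (F y) r \<partial>N)"
proof -
  \<comment> \<open>\<open>\<delta>\<close> may be infinite, so a finite positive minorant replaces
    it.\<close>
  obtain d :: real where d: "0 < d" "ennreal d \<le> \<delta>"
    using \<open>0 < \<delta>\<close> by (cases \<delta>) (auto intro: that[of 1])
  obtain \<beta> :: real where \<beta>: "0 \<le> \<beta>" "(\<integral>\<^sup>+y. b y \<partial>N) = ennreal \<beta>"
    using b(1) by (cases "\<integral>\<^sup>+y. b y \<partial>N") auto
  \<comment> \<open>Chosen so that the region \<open>F \<le> s\<close> carries at most
    \<open>d / 4\<close> of the mass; the summand 1 covers \<open>\<beta> = 0\<close>.\<close>
  define s where "s = d / (4 * (\<beta> + 1))"
  have s: "0 < s" "s * \<beta> \<le> d / 4"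
    using d \<beta> by (auto simp: s_def field_simps)
  define B where "B t y = b y * indicator {y. \<kappa> y < ennreal t * b y} y" for t y
  have [measurable]: "B t \<in> borel_measurable N" for t
    unfolding B_def by measurable
  \<comment> \<open>Every point eventually leaves the sets \<open>\<kappa> < b / (n + 1)\<close>,
    because \<open>\<kappa>\<close> is positive and \<open>b\<close> is finite; \<open>b\<close>
    itself dominates.\<close>
  have "(\<lambda>n. \<integral>\<^sup>+y. B (1 / Suc n) y \<partial>N) \<longlonglongrightarrow> (\<integral>\<^sup>+y. 0 \<partial>N)"
  proof (rule nn_integral_dominated_convergence[where w = b])
    show "AE y in N. (\<lambda>n. B (1 / Suc n) y) \<longlonglongrightarrow> 0"
    proof (rule AE_I2)
      fix y assume y: "y \<in> space N"
      have "(\<lambda>n. ennreal (1 / Suc n) * b y) \<longlonglongrightarrow> ennreal 0 * b y"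
        using b(2)[OF y] LIMSEQ_inverse_real_of_nat
        by (intro tendsto_mult_ennreal tendsto_ennrealI tendsto_const) (auto simp: inverse_eq_divide)
      then have "(\<lambda>n. ennreal (1 / Suc n) * b y) \<longlonglongrightarrow> 0"
        by simp
      then have "eventually (\<lambda>n. ennreal (1 / Suc n) * b y < \<kappa> y) sequentially"
        using \<kappa>[OF y] by (rule order_tendstoD)
      then have "eventually (\<lambda>n. B (1 / Suc n) y = 0) sequentially"
        by eventually_elim (auto simp: B_def)
      then show "(\<lambda>n. B (1 / Suc n) y) \<longlonglongrightarrow> 0"
        by (rule tendsto_eventually)
    qed
  qed (use b in \<open>auto simp: B_def indicator_def\<close>)
  then have "(\<lambda>n. \<integral>\<^sup>+y. B (1 / Suc n) y \<partial>N) \<longlonglongrightarrow> 0"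
    by simp
  then have "eventually (\<lambda>n. (\<integral>\<^sup>+y. B (1 / Suc n) y \<partial>N) < ennreal (d / 4)) sequentially"
    using d by (intro order_tendstoD) auto
  then obtain n where n: "(\<integral>\<^sup>+y. B (1 / Suc n) y \<partial>N) < ennreal (d / 4)"
    by (auto simp: eventually_sequentially)
  define t :: real where "t = 1 / Suc n"
  have t: "0 < t" "(\<integral>\<^sup>+y. B t y \<partial>N) \<le> ennreal (d / 4)"
    using n by (auto simp: t_def)
  define C where "C = t * s powr r"
  have C: "0 < C"
    using t s by (simp add: C_def)
  have "ennreal (C * d / 2) \<le> (\<integral>\<^sup>+y. \<kappa> y * ennreal_powr (F y) r \<partial>N)"
    if [measurable]: "F \<in> borel_measurable N" and F: "\<forall>y\<in>space N. F y \<le> 1" "\<delta> \<le> (\<integral>\<^sup>+y. b y * F y \<partial>N)"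
    for F
  proof -
    \<comment> \<open>\<open>b F\<close> is at most \<open>s b\<close> where \<open>F \<le> s\<close>, at most \<open>b\<close> on the small set where \<open>\<kappa> < t b\<close>, and at most
      \<open>\<kappa> F\<^sup>r / (t s\<^sup>r)\<close> elsewhere.\<close>
    have "ennreal C * (b y * F y) \<le> ennreal C * (ennreal s * b y + B t y) + \<kappa> y * ennreal_powr (F y) r"
      if "y \<in> space N" for y
    proof -
      have F1: "b y * F y \<le> b y"
        using F(1) that mult_left_mono[of "F y" 1 "b y"] by simp
      consider "F y \<le> ennreal s" | "\<kappa> y < ennreal t * b y" | "ennreal s \<le> F y" "ennreal t * b y \<le> \<kappa> y"
        by fastforce
      then show ?thesis
      proof cases
        case 1
        then have "b y * F y \<le> ennreal s * b y + B t y"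
          by (metis mult.commute mult_left_mono zero_le add_increasing2)
        then have "ennreal C * (b y * F y) \<le> ennreal C * (ennreal s * b y + B t y)"
          by (rule mult_left_mono) simp
        then show ?thesis
          by (rule add_increasing2[OF zero_le])
      next
        case 2
        then have "b y * F y \<le> ennreal s * b y + B t y"
          using F1 by (simp add: B_def add_increasing)
        then have "ennreal C * (b y * F y) \<le> ennreal C * (ennreal s * b y + B t y)"
          by (rule mult_left_mono) simp
        then show ?thesis
          by (rule add_increasing2[OF zero_le])
      next
        case 3
        have "ennreal (s powr r) \<le> ennreal_powr (F y) r"
          using ennreal_powr_mono[OF _ 3(1), of r] s \<open>0 < r\<close> by (simp add: ennreal_powr_ennreal)
        then have "ennreal t * b y * ennreal (s powr r) \<le> \<kappa> y * ennreal_powr (F y) r"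
          by (intro mult_mono 3) auto
        moreover have "ennreal t * b y * ennreal (s powr r) = ennreal C * b y"
          using t s by (simp add: C_def ennreal_mult ac_simps)
        moreover have "ennreal C * (b y * F y) \<le> ennreal C * b y"
          by (intro mult_left_mono F1) simp
        ultimately show ?thesis
          by (intro add_increasing) auto
      qed
    qed
    then have "(\<integral>\<^sup>+y. ennreal C * (b y * F y) \<partial>N)
        \<le> (\<integral>\<^sup>+y. ennreal C * (ennreal s * b y + B t y) + \<kappa> y * ennreal_powr (F y) r \<partial>N)"
      by (rule nn_integral_mono)
    also have "\<dots> = ennreal C * (ennreal s * ennreal \<beta> + (\<integral>\<^sup>+y. B t y \<partial>N))
        + (\<integral>\<^sup>+y. \<kappa> y * ennreal_powr (F y) r \<partial>N)"
      by (simp add: nn_integral_add nn_integral_cmult \<beta>)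
    also have "ennreal s * ennreal \<beta> + (\<integral>\<^sup>+y. B t y \<partial>N) \<le> ennreal (d / 4) + ennreal (d / 4)"
      using s \<beta> t by (intro add_mono) (auto simp: ennreal_mult[symmetric] intro!: ennreal_leI)
    also have "\<dots> = ennreal (d / 2)"
      using d by (simp flip: ennreal_plus)
    also have "ennreal C * ennreal (d / 2) = ennreal (C * d / 2)"
      using C d by (simp flip: ennreal_mult)
    also have "(\<integral>\<^sup>+y. ennreal C * (b y * F y) \<partial>N) = ennreal C * (\<integral>\<^sup>+y. b y * F y \<partial>N)"
      by (simp add: nn_integral_cmult)
    finally have "ennreal C * (\<integral>\<^sup>+y. b y * F y \<partial>N)
        \<le> ennreal (C * d / 2) + (\<integral>\<^sup>+y. \<kappa> y * ennreal_powr (F y) r \<partial>N)"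
      by (simp add: add_right_mono mult_left_mono)
    moreover have "ennreal (C * d) \<le> ennreal C * (\<integral>\<^sup>+y. b y * F y \<partial>N)"
      using C d F(2) by (auto simp: ennreal_mult intro!: mult_left_mono intro: order_trans)
    ultimately have "ennreal (C * d) \<le> ennreal (C * d / 2) + (\<integral>\<^sup>+y. \<kappa> y * ennreal_powr (F y) r \<partial>N)"
      by (rule order_trans[rotated])
    \<comment> \<open>The two bad regions absorb at most half of \<open>C * d\<close>. That half is
      finite and can be cancelled, so the other half bounds the integral from below.\<close>
    moreover have "ennreal (C * d) = ennreal (C * d / 2) + ennreal (C * d / 2)"
      using C d by (simp flip: ennreal_plus)
    ultimately show ?thesis
      by (simp add: ennreal_add_left_cancel_le)
  qed
  moreover have "0 < ennreal (C * d / 2)"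
    using C d by simp
  ultimately show ?thesis
    by blast
qed

section \<open>Integral operators on \<open>[0,\<infinity>]\<close>-valued functions\<close>

text \<open>With values in \<open>[0,\<infinity>]\<close>, Fatou and Tonelli apply without
  integrability conditions. The kernel is curried so that the transposed operator is
  \<open>kernel_int\<close> with swapped arguments.\<close>

definition kernel_int :: "'a measure \<Rightarrow> ('b \<Rightarrow> 'a \<Rightarrow> ennreal) \<Rightarrow> ('a \<Rightarrow> ennreal) \<Rightarrow> 'b \<Rightarrow> ennreal" where
  "kernel_int M k f y = (\<integral>\<^sup>+x. k y x * f x \<partial>M)"

lemma borel_measurable_kernel_int [measurable (raw)]:
  assumes "sigma_finite_measure M"
    and [measurable]: "(\<lambda>(y, x). k y x) \<in> borel_measurable (N \<Otimes>\<^sub>M M)" "f \<in> borel_measurable M"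
  shows "kernel_int M k f \<in> borel_measurable N"
proof -
  interpret sigma_finite_measure M by fact
  show ?thesis
    unfolding kernel_int_def by measurable
qed

lemma kernel_section_measurable:
  assumes "(\<lambda>(y, x). k y x) \<in> borel_measurable (N \<Otimes>\<^sub>M M)" "y \<in> space N"
  shows "k y \<in> borel_measurable M"
  using measurable_Pair2[OF assms] by simp

lemma kernel_swap_measurable:
  assumes [measurable]: "(\<lambda>(y, x). k y x) \<in> borel_measurable (N \<Otimes>\<^sub>M M)"
  shows "(\<lambda>(x, y). k y x) \<in> borel_measurable (M \<Otimes>\<^sub>M N)"
  by measurable

lemma kernel_int_liminf_le:
  fixes f :: "nat \<Rightarrow> 'a \<Rightarrow> ennreal"
  assumes [measurable]: "k y \<in> borel_measurable M" "\<And>n. f n \<in> borel_measurable M"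
  shows "kernel_int M k (\<lambda>x. liminf (\<lambda>n. f n x)) y \<le> liminf (\<lambda>n. kernel_int M k (f n) y)"
proof -
  \<comment> \<open>Multiplication commutes with suprema, but only an inequality is available for
    infima: the kernel may be infinite while \<open>f n x\<close> decreases to 0.\<close>
  have "k y x * liminf (\<lambda>n. f n x) \<le> liminf (\<lambda>n. k y x * f n x)" for x
    unfolding liminf_SUP_INF SUP_mult_left_ennreal
    by (intro SUP_mono' INF_greatest mult_left_mono INF_lower) auto
  then have "kernel_int M k (\<lambda>x. liminf (\<lambda>n. f n x)) y \<le> (\<integral>\<^sup>+x. liminf (\<lambda>n. k y x * f n x) \<partial>M)"
    unfolding kernel_int_def by (rule nn_integral_mono)
  also have "\<dots> \<le> liminf (\<lambda>n. kernel_int M k (f n) y)"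
    unfolding kernel_int_def by (rule nn_integral_liminf) measurable
  finally show ?thesis .
qed

text \<open>The sets of finite measure on which \<open>w \<ge> 1 / (n + 1)\<close> exhaust a space
  that is not null, so one of them has positive measure.\<close>

lemma exists_set_weight_ge:
  assumes "sigma_finite_measure M" "emeasure M (space M) \<noteq> 0"
    and [measurable]: "w \<in> borel_measurable M" and w: "\<And>x. x \<in> space M \<Longrightarrow> 0 < w x"
  shows "\<exists>A\<in>sets M. \<exists>\<delta>::ennreal. 0 < \<delta> \<and> 0 < emeasure M A \<and> emeasure M A < \<infinity> \<and> (\<forall>x\<in>A. \<delta> \<le> w x)"
proof -
  interpret sigma_finite_measure M by fact
  obtain S :: "nat \<Rightarrow> 'a set" where S: "range S \<subseteq> sets M" "(\<Union>i. S i) = space M" "\<And>i. emeasure M (S i) \<noteq> \<infinity>" "incseq S"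
    by (rule sigma_finite_incseq) blast
  have [measurable]: "S i \<in> sets M" for i
    using S(1) by auto
  define A where "A n = S n \<inter> {x\<in>space M. ennreal (1 / Suc n) \<le> w x}" for n
  have [measurable]: "A n \<in> sets M" for n
    unfolding A_def by measurable
  have "space M \<subseteq> (\<Union>n. A n)"
  proof
    fix x assume x: "x \<in> space M"
    then obtain i where i: "x \<in> S i"
      using S(2) by blast
    have "(\<lambda>n. ennreal (1 / Suc n)) \<longlonglongrightarrow> ennreal 0"
      using LIMSEQ_inverse_real_of_nat by (intro tendsto_ennrealI) (auto simp: inverse_eq_divide)
    then have "eventually (\<lambda>n. ennreal (1 / Suc n) < w x) sequentially"
      using w[OF x] by (intro order_tendstoD) auto
    then obtain m where "\<And>n. m \<le> n \<Longrightarrow> ennreal (1 / Suc n) < w x"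
      by (auto simp: eventually_sequentially)
    moreover have "x \<in> S (max i m)"
      using i S(4) by (meson incseqD max.cobounded1 subsetD)
    ultimately have "x \<in> A (max i m)"
      using x by (auto simp: A_def intro: less_imp_le)
    then show "x \<in> (\<Union>n. A n)" by blast
  qed
  then have "(\<Union>n. A n) = space M"
    using sets.sets_into_space by (auto simp: A_def)
  then obtain n where n: "emeasure M (A n) \<noteq> 0"
    using assms(2) emeasure_UN_eq_0[of M A] by (metis \<open>\<And>n. A n \<in> sets M\<close> image_subset_iff)
  have "emeasure M (A n) \<le> emeasure M (S n)"
    by (intro emeasure_mono) (auto simp: A_def)
  then have "emeasure M (A n) < \<infinity>"
    using S(3)[of n] by (simp add: less_top order_le_less_trans)
  then show ?thesis
    using n by (intro bexI[of _ "A n"] exI[of _ "ennreal (1 / Suc n)"]) (auto simp: A_def zero_less_iff_neq_zero)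
qed

text \<open>Since the kernel is strictly positive, finiteness of the integral at a single
  \<open>y\<close> already controls \<open>f\<close> on the whole space.\<close>

lemma AE_finite_of_kernel_int_finite:
  assumes [measurable]: "k y \<in> borel_measurable M" "f \<in> borel_measurable M"
    and "\<And>x. x \<in> space M \<Longrightarrow> 0 < k y x" and "kernel_int M k f y < \<infinity>"
  shows "AE x in M. f x < \<infinity>"
proof -
  have "AE x in M. k y x * f x \<noteq> \<infinity>"
    using assms(4) by (intro nn_integral_PInf_AE) (auto simp: kernel_int_def)
  then show ?thesis
    using AE_space by eventually_elim (use assms(3) in \<open>auto simp: ennreal_mult_eq_top_iff less_top zero_less_iff_neq_zero\<close>)
qed

text \<open>Tonelli's theorem; it identifies the transposed kernel as the candidate for the
  adjoint.\<close>

lemma kernel_int_transpose: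
  assumes "sigma_finite_measure M" "sigma_finite_measure N"
    and [measurable]: "(\<lambda>(y, x). k y x) \<in> borel_measurable (N \<Otimes>\<^sub>M M)"
      "f \<in> borel_measurable M" "g \<in> borel_measurable N"
  shows "(\<integral>\<^sup>+y. g y * kernel_int M k f y \<partial>N) = (\<integral>\<^sup>+x. f x * kernel_int N (\<lambda>x y. k y x) g x \<partial>M)"
proof -
  interpret M: sigma_finite_measure M by fact
  interpret N: sigma_finite_measure N by fact
  interpret pair_sigma_finite N M ..
  note [measurable] = kernel_section_measurable[OF assms(3)]
    kernel_section_measurable[OF kernel_swap_measurable[OF assms(3)]]
  have "(\<integral>\<^sup>+y. g y * kernel_int M k f y \<partial>N) = (\<integral>\<^sup>+y. (\<integral>\<^sup>+x. g y * (k y x * f x) \<partial>M) \<partial>N)"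
    by (intro nn_integral_cong) (simp add: kernel_int_def nn_integral_cmult)
  also have "\<dots> = (\<integral>\<^sup>+x. (\<integral>\<^sup>+y. g y * (k y x * f x) \<partial>N) \<partial>M)"
    by (rule Fubini'[symmetric]) measurable
  also have "\<dots> = (\<integral>\<^sup>+x. (\<integral>\<^sup>+y. f x * (k y x * g y) \<partial>N) \<partial>M)"
    by (simp add: ac_simps)
  also have "\<dots> = (\<integral>\<^sup>+x. f x * kernel_int N (\<lambda>x y. k y x) g x \<partial>M)"
    by (intro nn_integral_cong) (simp add: kernel_int_def nn_integral_cmult)
  finally show ?thesis .
qed

lemma kernel_int_mono:
  assumes "\<And>x. x \<in> space M \<Longrightarrow> f x \<le> g x"
  shows "kernel_int M k f y \<le> kernel_int M k g y"
  unfolding kernel_int_def by (intro nn_integral_mono mult_left_mono assms) auto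

lemma kernel_int_cong_AE:
  assumes "AE x in M. f x = g x"
  shows "kernel_int M k f y = kernel_int M k g y"
  unfolding kernel_int_def using assms by (intro nn_integral_cong_AE) auto

lemma kernel_int_cmult:
  assumes [measurable]: "k y \<in> borel_measurable M" "f \<in> borel_measurable M"
  shows "kernel_int M k (\<lambda>x. c * f x) y = c * kernel_int M k f y"
  unfolding kernel_int_def
  by (subst nn_integral_cmult[symmetric]) (auto simp: ac_simps)

section \<open>The nonlinear operator and its supersolutions\<close>

text \<open>The map sending \<open>f\<close> to the adjoint of \<open>T\<close> applied to
  \<open>(T f)^r\<close>, written purely with the kernel. It is defined at every point, without
  choosing representatives.\<close>

definition nonlinear_int ::
    "'a measure \<Rightarrow> 'b measure \<Rightarrow> ('b \<Rightarrow> 'a \<Rightarrow> ennreal) \<Rightarrow> real \<Rightarrow> ('a \<Rightarrow> ennreal) \<Rightarrow> 'a \<Rightarrow> ennreal" where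
  "nonlinear_int M N k r f =
     kernel_int N (\<lambda>x y. k y x) (\<lambda>y. ennreal_powr (kernel_int M k f y) r)"

text \<open>Homogeneity of degree \<open>r\<close>: rescaling \<open>f\<close> preserves a bound by
  \<open>c\<close> times \<open>f^r\<close> with the same \<open>c\<close>, which permits the
  normalisation.\<close>

lemma nonlinear_int_cmult:
  assumes "sigma_finite_measure M" "0 < r" "x \<in> space M"
    and [measurable]: "(\<lambda>(y, x). k y x) \<in> borel_measurable (N \<Otimes>\<^sub>M M)" "f \<in> borel_measurable M"
  shows "nonlinear_int M N k r (\<lambda>x. c * f x) x = ennreal_powr c r * nonlinear_int M N k r f x"
proof -
  note [measurable] = kernel_section_measurable[OF assms(4)]
    kernel_section_measurable[OF kernel_swap_measurable[OF assms(4)]]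
  have "nonlinear_int M N k r (\<lambda>x. c * f x) x =
      kernel_int N (\<lambda>x y. k y x) (\<lambda>y. ennreal_powr c r * ennreal_powr (kernel_int M k f y) r) x"
    unfolding nonlinear_int_def kernel_int_def[of N]
    by (intro nn_integral_cong) (simp add: kernel_int_cmult ennreal_powr_mult \<open>0 < r\<close>)
  also have "\<dots> = ennreal_powr c r * nonlinear_int M N k r f x"
    unfolding nonlinear_int_def using assms by (intro kernel_int_cmult) measurable
  finally show ?thesis .
qed

text \<open>Fatou for the inner integral, then monotone continuity of the power, then Fatou for the
  outer integral.\<close>

lemma nonlinear_int_liminf_le:
  fixes f :: "nat \<Rightarrow> 'a \<Rightarrow> ennreal"
  assumes "sigma_finite_measure M" "0 < r" "x \<in> space M"
    and [measurable]: "(\<lambda>(y, x). k y x) \<in> borel_measurable (N \<Otimes>\<^sub>M M)" "\<And>n. f n \<in> borel_measurable M"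
  shows "nonlinear_int M N k r (\<lambda>x. liminf (\<lambda>n. f n x)) x \<le> liminf (\<lambda>n. nonlinear_int M N k r (f n) x)"
proof -
  note [measurable] = kernel_section_measurable[OF assms(4)]
    kernel_section_measurable[OF kernel_swap_measurable[OF assms(4)]]
  have "nonlinear_int M N k r (\<lambda>x. liminf (\<lambda>n. f n x)) x
      \<le> kernel_int N (\<lambda>x y. k y x) (\<lambda>y. liminf (\<lambda>n. ennreal_powr (kernel_int M k (f n) y) r)) x"
    unfolding nonlinear_int_def liminf_ennreal_powr[OF \<open>0 < r\<close>]
    by (intro kernel_int_mono ennreal_powr_mono kernel_int_liminf_le) (use \<open>0 < r\<close> in auto)
  also have "\<dots> \<le> liminf (\<lambda>n. nonlinear_int M N k r (f n) x)"
    unfolding nonlinear_int_def using assms by (intro kernel_int_liminf_le) measurable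
  finally show ?thesis .
qed

text \<open>The order of quantifiers matters: \<open>A\<close> serves all points, and
  \<open>c\<close> may depend on \<open>x\<close> but not on \<open>f\<close>, so the bound survives
  a liminf over normalised functions.\<close>

lemma exists_nonlinear_int_lower_bound:
  assumes "sigma_finite_measure M" "sigma_finite_measure N" "0 < r"
    and [measurable]: "(\<lambda>(y, x). k y x) \<in> borel_measurable (N \<Otimes>\<^sub>M M)"
    and k: "\<And>y x. y \<in> space N \<Longrightarrow> x \<in> space M \<Longrightarrow> 0 < k y x"
    and nz: "emeasure M (space M) \<noteq> 0" "emeasure N (space N) \<noteq> 0"
  shows "\<exists>A\<in>sets M. 0 < emeasure M A \<and> emeasure M A < \<infinity> \<and>
    (\<forall>x\<in>space M. \<exists>c>0. \<forall>f\<in>borel_measurable M.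
       (\<integral>\<^sup>+x. f x * indicator A x \<partial>M) = 1 \<longrightarrow> c \<le> nonlinear_int M N k r f x)"
proof -
  interpret M: sigma_finite_measure M by fact
  interpret N: sigma_finite_measure N by fact
  note [measurable] = kernel_section_measurable[OF assms(4)]
    kernel_section_measurable[OF kernel_swap_measurable[OF assms(4)]]
  obtain b where [measurable]: "b \<in> borel_measurable N"
    and b: "(\<integral>\<^sup>+y. b y \<partial>N) \<noteq> \<infinity>" "\<And>y. y \<in> space N \<Longrightarrow> 0 < b y \<and> b y < \<infinity>"
    using N.Ex_finite_integrable_function by blast
  \<comment> \<open>Truncating the inner kernel makes the image of a normalised function at most 1;
    the outer kernel stays \<open>k\<close>. As \<open>k1 \<le> k\<close>, undoing the truncation
    only increases the nonlinear integral.\<close>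
  define k1 where "k1 y x = min (k y x) 1" for y x
  have [measurable]: "(\<lambda>(y, x). k1 y x) \<in> borel_measurable (N \<Otimes>\<^sub>M M)"
    unfolding k1_def by measurable
  define w where "w = kernel_int N (\<lambda>x y. k1 y x) b"
  have [measurable]: "w \<in> borel_measurable M"
    unfolding w_def using assms by measurable
  have "0 < w x" if x: "x \<in> space M" for x
  proof (rule ccontr)
    assume "\<not> 0 < w x"
    then have "(\<integral>\<^sup>+y. k1 y x * b y \<partial>N) = 0"
      by (simp add: w_def kernel_int_def)
    moreover have "(\<lambda>y. k1 y x * b y) \<in> borel_measurable N"
      using x by (simp add: k1_def)
    ultimately have "AE y in N. k1 y x * b y = 0"
      by (simp add: nn_integral_0_iff_AE)
    then have "AE y in N. False"
      using AE_space by eventually_elim (use b(2) k x in \<open>force simp: k1_def min_def split: if_splits\<close>)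
    then show False
      using nz by (simp add: AE_iff_measurable[of "space N"])
  qed
  then obtain A \<delta> where [measurable]: "A \<in> sets M"
    and A: "(0::ennreal) < \<delta>" "0 < emeasure M A" "emeasure M A < \<infinity>" "\<And>x. x \<in> A \<Longrightarrow> \<delta> \<le> w x"
    using exists_set_weight_ge[of M w] assms(1) nz(1) by auto
  have "\<exists>c>0. \<forall>f\<in>borel_measurable M.
       (\<integral>\<^sup>+x. f x * indicator A x \<partial>M) = 1 \<longrightarrow> c \<le> nonlinear_int M N k r f x" if x: "x \<in> space M" for x
  proof -
    obtain c where c: "c > 0" "\<And>F. F \<in> borel_measurable N \<Longrightarrow> (\<And>y. y \<in> space N \<Longrightarrow> F y \<le> 1) \<Longrightarrow>
        \<delta> \<le> (\<integral>\<^sup>+y. b y * F y \<partial>N) \<Longrightarrow> c \<le> (\<integral>\<^sup>+y. k y x * ennreal_powr (F y) r \<partial>N)"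
      using exists_kernel_lower_bound[of b N "\<lambda>y. k y x" \<delta> r] b k x A(1) \<open>0 < r\<close>
      by (auto simp: less_top)
    have "c \<le> nonlinear_int M N k r f x"
      if [measurable]: "f \<in> borel_measurable M" and f: "(\<integral>\<^sup>+x. f x * indicator A x \<partial>M) = 1" for f
    proof -
      define g where "g x = f x * indicator A x" for x
      have [measurable]: "g \<in> borel_measurable M"
        unfolding g_def by measurable
      have "kernel_int M k1 g y \<le> (\<integral>\<^sup>+x. g x \<partial>M)" for y
        unfolding kernel_int_def k1_def
        by (intro nn_integral_mono) (use mult_right_mono[of "min (k y _) 1" 1] in auto)
      then have 1: "kernel_int M k1 g y \<le> 1" for y
        using f by (simp add: g_def)
      \<comment> \<open>Testing the normalised \<open>g\<close> against \<open>w\<close>, which is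
        at least \<open>\<delta>\<close> on \<open>A\<close>, and exchanging the integrals gives the
        mass condition required for \<open>c\<close>.\<close>
      have "\<delta> = (\<integral>\<^sup>+x. g x * \<delta> \<partial>M)"
        using f by (simp add: nn_integral_multc g_def)
      also have "\<dots> \<le> (\<integral>\<^sup>+x. g x * w x \<partial>M)"
        by (intro nn_integral_mono) (auto simp: g_def indicator_def intro!: mult_left_mono A)
      also have "\<dots> = (\<integral>\<^sup>+y. b y * kernel_int M k1 g y \<partial>N)"
        unfolding w_def using assms by (intro kernel_int_transpose[symmetric]) measurable
      finally have "c \<le> (\<integral>\<^sup>+y. k y x * ennreal_powr (kernel_int M k1 g y) r \<partial>N)"
        using 1 assms by (intro c(2)) measurable
      also have "\<dots> \<le> nonlinear_int M N k r f x"
        unfolding nonlinear_int_def kernel_int_def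
        by (intro nn_integral_mono mult_left_mono ennreal_powr_mono mult_mono)
          (use \<open>0 < r\<close> in \<open>auto simp: k1_def g_def indicator_def\<close>)
      finally show ?thesis .
    qed
    then show ?thesis
      using c(1) by blast
  qed
  then show ?thesis
    using A \<open>A \<in> sets M\<close> by blast
qed

lemma AE_ex_in_set:
  assumes "A \<in> sets M" "0 < emeasure M A" "AE x in M. P x"
  shows "\<exists>x\<in>A. P x"
proof (rule ccontr)
  assume "\<not> (\<exists>x\<in>A. P x)"
  then have "AE x in M. x \<notin> A"
    using assms(3) by (auto elim: eventually_mono)
  then show False
    using assms by (simp add: AE_iff_null_sets[symmetric] null_sets_def)
qed

lemma exists_nonlinear_int_supersolution:
  fixes f :: "nat \<Rightarrow> 'a \<Rightarrow> ennreal"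
  assumes "sigma_finite_measure M" "sigma_finite_measure N" "0 < r"
    and [measurable]: "(\<lambda>(y, x). k y x) \<in> borel_measurable (N \<Otimes>\<^sub>M M)"
    and k: "\<And>y x. y \<in> space N \<Longrightarrow> x \<in> space M \<Longrightarrow> 0 < k y x"
    and [measurable]: "\<And>n. f n \<in> borel_measurable M"
    and pos: "\<And>n. AE x in M. 0 < f n x"
    and int: "\<And>n A. A \<in> sets M \<Longrightarrow> emeasure M A < \<infinity> \<Longrightarrow> (\<integral>\<^sup>+x. f n x * indicator A x \<partial>M) < \<infinity>"
    and le: "\<And>n. AE x in M. nonlinear_int M N k r (f n) x \<le> c n * ennreal_powr (f n x) r"
    and lim: "c \<longlonglongrightarrow> L" "L < \<infinity>"
  shows "\<exists>h\<in>borel_measurable M. (AE x in M. 0 < h x \<and> h x < \<infinity>) \<and>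
    (AE x in M. nonlinear_int M N k r h x \<le> L * ennreal_powr (h x) r)"
\<comment> \<open>On a null space \<open>M\<close> every a.e. claim is trivial; on a null space
  \<open>N\<close> the nonlinear integral vanishes. The constant 1 serves in both cases.\<close>
proof (cases "emeasure M (space M) = 0 \<or> emeasure N (space N) = 0")
  case True
  then show ?thesis
  proof
    assume "emeasure M (space M) = 0"
    then have "AE x in M. False"
      by (intro AE_I[of _ _ "space M"]) auto
    then show ?thesis
      by (intro bexI[of _ "\<lambda>_. 1"]) (auto elim: eventually_mono)
  next
    assume "emeasure N (space N) = 0"
    then have "AE y in N. False"
      by (intro AE_I[of _ _ "space N"]) auto
    then have "kernel_int N (\<lambda>x y. k y x) g x = kernel_int N (\<lambda>x y. k y x) (\<lambda>_. 0) x" for g x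
      by (intro kernel_int_cong_AE) (auto elim: eventually_mono)
    then have "nonlinear_int M N k r h x = 0" for h x
      unfolding nonlinear_int_def by (simp add: kernel_int_def)
    then show ?thesis
      by (intro bexI[of _ "\<lambda>_. 1"]) auto
  qed
next
  case False
  then have nz: "emeasure M (space M) \<noteq> 0" "emeasure N (space N) \<noteq> 0"
    by auto
  note [measurable] = kernel_section_measurable[OF assms(4)]
    kernel_section_measurable[OF kernel_swap_measurable[OF assms(4)]]
  obtain A where [measurable]: "A \<in> sets M" and A: "0 < emeasure M A" "emeasure M A < \<infinity>"
    and low: "\<forall>x\<in>space M. \<exists>c>0. \<forall>f\<in>borel_measurable M.
       (\<integral>\<^sup>+x. f x * indicator A x \<partial>M) = 1 \<longrightarrow> c \<le> nonlinear_int M N k r f x"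
    using exists_nonlinear_int_lower_bound[OF assms(1-4) k nz] by blast
  \<comment> \<open>Normalising constants. Positivity of \<open>f n\<close> on a set of positive
    measure and \<open>int\<close> put them strictly between 0 and \<open>\<infinity>\<close>, so
    \<open>inverse\<close> is a genuine reciprocal.\<close>
  define a where "a n = (\<integral>\<^sup>+x. f n x * indicator A x \<partial>M)" for n
  have "a n \<noteq> 0" for n
  proof
    assume "a n = 0"
    then have "AE x in M. f n x * indicator A x = 0"
      unfolding a_def by (subst (asm) nn_integral_0_iff_AE) auto
    then have "AE x in M. x \<notin> A"
      using pos[of n] by eventually_elim (auto simp: indicator_def split: if_splits)
    then show False
      using AE_ex_in_set[OF _ A(1)] by fastforce
  qed
  moreover have "a n \<noteq> \<infinity>" for n
    using int[of A n] A(2) by (simp add: a_def)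
  ultimately have a: "inverse (a n) * a n = 1" for n
    by (simp add: ennreal_inverse_mult less_top mult.commute ennreal_divide_self divide_ennreal_def[symmetric])
  define g where "g n x = inverse (a n) * f n x" for n x
  have [measurable]: "g n \<in> borel_measurable M" for n
    unfolding g_def by measurable
  have g_int: "(\<integral>\<^sup>+x. g n x * indicator A x \<partial>M) = 1" for n
  proof -
    have "(\<integral>\<^sup>+x. g n x * indicator A x \<partial>M) = inverse (a n) * a n"
      unfolding a_def g_def by (subst nn_integral_cmult[symmetric]) (auto simp: ac_simps)
    then show ?thesis
      by (simp add: a)
  qed
  have g_le: "AE x in M. \<forall>n. nonlinear_int M N k r (g n) x \<le> c n * ennreal_powr (g n x) r"
  proof (rule AE_all_countable[THEN iffD2], rule allI)
    fix n
    show "AE x in M. nonlinear_int M N k r (g n) x \<le> c n * ennreal_powr (g n x) r"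
      using le[of n] AE_space
    proof eventually_elim
      case (elim x)
      then have "nonlinear_int M N k r (g n) x
          = ennreal_powr (inverse (a n)) r * nonlinear_int M N k r (f n) x"
        unfolding g_def by (intro nonlinear_int_cmult) (use assms in auto)
      also have "\<dots> \<le> ennreal_powr (inverse (a n)) r * (c n * ennreal_powr (f n x) r)"
        by (intro mult_left_mono elim) auto
      also have "\<dots> = c n * ennreal_powr (g n x) r"
        by (simp add: g_def ennreal_powr_mult \<open>0 < r\<close> ac_simps)
      finally show ?case .
    qed
  qed
  define h where "h x = liminf (\<lambda>n. g n x)" for x
  have [measurable]: "h \<in> borel_measurable M"
    unfolding h_def by measurable
  \<comment> \<open>The premise \<open>h x < \<infinity>\<close> avoids the product
    \<open>0 * \<infinity>\<close> on the right when \<open>L = 0\<close>. It is discharged by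
    \<open>h_finite\<close>, whose proof needs this implication at one point only.\<close>
  have h_le: "nonlinear_int M N k r h x \<le> L * ennreal_powr (h x) r" (is ?A)
    and h_pos: "0 < h x" (is ?B)
    if x: "x \<in> space M" "\<forall>n. nonlinear_int M N k r (g n) x \<le> c n * ennreal_powr (g n x) r" "h x < \<infinity>"
    for x
  proof -
    have "liminf (\<lambda>n. nonlinear_int M N k r (g n) x) \<le> liminf (\<lambda>n. c n * ennreal_powr (g n x) r)"
      using x(2) by (intro Liminf_mono) auto
    also have "ennreal_powr (h x) r < \<infinity>"
      using x(3) by (cases "h x") (auto simp: ennreal_powr_ennreal)
    then have "liminf (\<lambda>n. c n * ennreal_powr (g n x) r) \<le> L * ennreal_powr (h x) r"
      using liminf_mult_le[OF lim, of "\<lambda>n. ennreal_powr (g n x) r"]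
      by (simp add: liminf_ennreal_powr \<open>0 < r\<close> h_def)
    finally have *: "liminf (\<lambda>n. nonlinear_int M N k r (g n) x) \<le> L * ennreal_powr (h x) r" .
    have "nonlinear_int M N k r h x \<le> liminf (\<lambda>n. nonlinear_int M N k r (g n) x)"
      unfolding h_def using assms x(1) by (intro nonlinear_int_liminf_le) auto
    with * show ?A
      by (rule order_trans[rotated])
    \<comment> \<open>The bound \<open>d\<close> survives the liminf, so the right-hand side cannot
      vanish, as it would for \<open>h x = 0\<close>.\<close>
    obtain d where d: "d > 0" "\<And>n. d \<le> nonlinear_int M N k r (g n) x"
      using low x(1) g_int by (metis \<open>\<And>n. g n \<in> borel_measurable M\<close>)
    have "d \<le> liminf (\<lambda>n. nonlinear_int M N k r (g n) x)"
      using d(2) by (intro Liminf_bounded) auto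
    then have "0 < L * ennreal_powr (h x) r"
      using * d(1) by (meson less_le_trans)
    then show ?B
      by (cases "h x = 0") (auto simp: zero_less_iff_neq_zero)
  qed
  have h_finite: "AE x in M. h x < \<infinity>"
  proof -
    have "(\<integral>\<^sup>+x. h x * indicator A x \<partial>M) = (\<integral>\<^sup>+x. liminf (\<lambda>n. g n x * indicator A x) \<partial>M)"
      by (intro nn_integral_cong) (auto simp: h_def indicator_def Liminf_const)
    also have "\<dots> \<le> liminf (\<lambda>n. \<integral>\<^sup>+x. g n x * indicator A x \<partial>M)"
      by (rule nn_integral_liminf) measurable
    also have "\<dots> = 1"
      by (simp add: g_int Liminf_const)
    finally have "AE x in M. h x * indicator A x \<noteq> \<infinity>"
      by (intro nn_integral_PInf_AE) (auto simp: top_unique)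
    then have "AE x in M. (x \<in> A \<longrightarrow> h x < \<infinity>) \<and> x \<in> space M \<and>
        (\<forall>n. nonlinear_int M N k r (g n) x \<le> c n * ennreal_powr (g n x) r)"
      using g_le AE_space by eventually_elim (auto simp: less_top)
    \<comment> \<open>One good point of \<open>A\<close> is enough: a finite nonlinear integral at
      \<open>x\<close> makes \<open>kernel_int M k h\<close> finite a.e., and a single such
      \<open>y\<close> carries finiteness of \<open>h\<close> from \<open>A\<close> to the whole
      space.\<close>
    then obtain x where x: "x \<in> space M" "h x < \<infinity>"
        "\<forall>n. nonlinear_int M N k r (g n) x \<le> c n * ennreal_powr (g n x) r"
      using AE_ex_in_set[OF _ A(1)] by fastforce
    have "L * ennreal_powr (h x) r < \<infinity>"
      using x(2) lim(2) by (cases "h x") (auto simp: ennreal_powr_ennreal ennreal_mult_less_top)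
    then have "nonlinear_int M N k r h x < \<infinity>"
      using h_le[OF x(1,3,2)] by (rule order_le_less_trans[rotated])
    then have "AE y in N. ennreal_powr (kernel_int M k h y) r < \<infinity>"
      unfolding nonlinear_int_def
      by (intro AE_finite_of_kernel_int_finite[where k = "\<lambda>x y. k y x" and y = x]) (use x(1) k assms in auto)
    then obtain y where y: "y \<in> space N" "ennreal_powr (kernel_int M k h y) r < \<infinity>"
      using AE_ex_in_set[of "space N" N] nz by (auto simp: zero_less_iff_neq_zero)
    then have "kernel_int M k h y < \<infinity>"
      by (cases "kernel_int M k h y") auto
    then show ?thesis
      using y(1) k by (intro AE_finite_of_kernel_int_finite[where k = k and y = y]) auto
  qed
  have "AE x in M. 0 < h x \<and> h x < \<infinity> \<and> nonlinear_int M N k r h x \<le> L * ennreal_powr (h x) r"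
    using h_finite g_le AE_space by eventually_elim (use h_le h_pos in auto)
  then show ?thesis
    by (intro bexI[of _ h]) auto
qed

subsection \<open>Lebesgue spaces and their duality\<close>

lemma conjugate_exponent_gt_1:
  fixes p q :: real
  assumes "1 < p" "1 / p + 1 / q = 1"
  shows "1 < q"
proof -
  have "0 < 1 / p" "1 / p < 1"
    using assms(1) by auto
  then have "0 < 1 / q" "1 / q < 1"
    using assms(2) by linarith+
  then show ?thesis
    by (simp add: zero_less_divide_1_iff)
qed

lemma conjugate_exponent_eq:
  fixes p q :: real
  assumes "1 < p" "1 / p + 1 / q = 1"
  shows "(p - 1) * q = p" "q / p + 1 = q"
proof -
  have "1 < q"
    using conjugate_exponent_gt_1[OF assms] .
  then have "p + q = p * q"
    using assms by (simp add: field_simps)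
  then show "(p - 1) * q = p" "q / p + 1 = q"
    using assms(1) by (simp_all add: field_simps)
qed

text \<open>Young's inequality dominates the product by integrable powers; this is the qualitative
  form of Hoelder's inequality.\<close>

lemma integrable_mult_Lp:
  assumes "1 < p" "1 / p + 1 / q = 1" "f \<in> Lp M p" "g \<in> Lp M q"
  shows "integrable M (\<lambda>x. f x * g x)"
proof (rule Bochner_Integration.integrable_bound)
  show "integrable M (\<lambda>x. \<bar>f x\<bar> powr p / p + \<bar>g x\<bar> powr q / q)"
    using assms(3,4) by (auto simp: Lp_def)
  show "(\<lambda>x. f x * g x) \<in> borel_measurable M"
    using assms(3,4) by (auto simp: Lp_def)
  show "AE x in M. norm (f x * g x) \<le> norm (\<bar>f x\<bar> powr p / p + \<bar>g x\<bar> powr q / q)"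
  proof (rule AE_I2)
    fix x
    have "\<bar>f x\<bar> * \<bar>g x\<bar> \<le> \<bar>f x\<bar> powr p / p + \<bar>g x\<bar> powr q / q"
      using conjugate_exponent_gt_1 assms by (intro Youngs_inequality) auto
    then show "norm (f x * g x) \<le> norm (\<bar>f x\<bar> powr p / p + \<bar>g x\<bar> powr q / q)"
      by (simp add: abs_mult)
  qed
qed

lemma Lp_bounded_by:
  assumes "g \<in> Lp M p" "f \<in> borel_measurable M" "0 \<le> p" "\<And>x. x \<in> space M \<Longrightarrow> \<bar>f x\<bar> \<le> \<bar>g x\<bar>"
  shows "f \<in> Lp M p"
proof -
  have "integrable M (\<lambda>x. \<bar>f x\<bar> powr p)"
  proof (rule Bochner_Integration.integrable_bound)
    show "integrable M (\<lambda>x. \<bar>g x\<bar> powr p)"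
      using assms(1) by (simp add: Lp_def)
    show "(\<lambda>x. \<bar>f x\<bar> powr p) \<in> borel_measurable M"
      using assms(2) by measurable
    show "AE x in M. norm (\<bar>f x\<bar> powr p) \<le> norm (\<bar>g x\<bar> powr p)"
      using assms(3,4) by (intro AE_I2) (simp add: powr_mono2)
  qed
  then show ?thesis
    using assms(2) by (simp add: Lp_def)
qed

text \<open>Take the \<open>p\<close>-th root of a strictly positive integrable function, which
  exists by \<open>\<sigma>\<close>-finiteness.\<close>

lemma exists_positive_Lp:
  assumes "sigma_finite_measure M" "0 < p"
  shows "\<exists>a\<in>Lp M p. \<forall>x\<in>space M. 0 < a x"
proof -
  interpret sigma_finite_measure M by fact
  obtain b where [measurable]: "b \<in> borel_measurable M"
    and b: "(\<integral>\<^sup>+y. b y \<partial>M) \<noteq> \<infinity>" "\<And>y. y \<in> space M \<Longrightarrow> 0 < b y \<and> b y < \<infinity>"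
    using Ex_finite_integrable_function by blast
  have "integrable M (\<lambda>x. enn2real (b x))"
  proof (rule integrableI_nonneg)
    have "(\<integral>\<^sup>+x. ennreal (enn2real (b x)) \<partial>M) = (\<integral>\<^sup>+x. b x \<partial>M)"
      using b(2) by (intro nn_integral_cong) auto
    then show "(\<integral>\<^sup>+x. ennreal (enn2real (b x)) \<partial>M) < \<infinity>"
      using b(1) by (simp add: less_top)
  qed auto
  then have "(\<lambda>x. enn2real (b x) powr (1 / p)) \<in> Lp M p"
    using assms(2) by (simp add: Lp_def powr_powr)
  moreover have "0 < enn2real (b x) powr (1 / p)" if "x \<in> space M" for x
    using b(2)[OF that] by (cases "b x") auto
  ultimately show ?thesis
    by (intro bexI[of _ "\<lambda>x. enn2real (b x) powr (1 / p)"] ballI)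
qed

section \<open>Converse of Hoelder's inequality and uniqueness of the dual function\<close>

text \<open>The right-hand side equals \<open>J powr (1 / q) * X powr (- 1 / p)\<close>, and
  \<open>J powr (1 / q) \<ge> X\<close>. In use, \<open>X = 2 ^ j\<close> and \<open>J\<close> is
  the integral of a truncation of \<open>u powr q\<close>.\<close>

lemma powr_conjugate_le:
  fixes p q :: real
  assumes "1 < p" "1 / p + 1 / q = 1" "0 < X" "X powr q \<le> J"
  shows "X powr (1 / q) \<le> (1 / (X * J)) powr (1 / p) * J"
proof -
  have q: "1 < q"
    using conjugate_exponent_gt_1 assms by blast
  have J: "0 < J"
    using assms(3,4) by (smt (verit) powr_gt_zero)
  have "X = (X powr q) powr (1 / q)"
    using assms q by (simp add: powr_powr)
  also have "\<dots> \<le> J powr (1 / q)"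
    using assms q by (intro powr_mono2) auto
  finally have "X * X powr (- 1 / p) \<le> J powr (1 / q) * X powr (- 1 / p)"
    by (intro mult_right_mono) auto
  moreover have "X * X powr (- 1 / p) = X powr (1 / q)"
  proof -
    have "1 / q = 1 + - 1 / p"
      using assms(2) by simp
    then have "X powr (1 / q) = X powr 1 * X powr (- 1 / p)"
      by (simp only: powr_add)
    then show ?thesis
      using assms(3) by simp
  qed
  moreover have "(1 / (X * J)) powr (1 / p) * J = J powr (1 / q) * X powr (- 1 / p)"
  proof -
    have "1 / q = 1 + - 1 / p"
      using assms(2) by simp
    then have "J powr (1 / q) = J powr 1 * J powr (- 1 / p)"
      by (simp only: powr_add)
    moreover have "(1 / (X * J)) powr (1 / p) = X powr (- 1 / p) * J powr (- 1 / p)"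
      using assms(3) J by (simp add: powr_divide powr_mult powr_minus_divide)
    ultimately show ?thesis
      using J by simp
  qed
  ultimately show ?thesis
    by simp
qed

text \<open>A gliding-hump argument in place of uniform boundedness: if \<open>u powr q\<close> had
  infinite integral, one function \<open>f\<close> in \<open>Lp M p\<close> could be assembled from
  truncations so that its pairing with \<open>u\<close> exceeds every bound.\<close>

lemma Lp_of_integrable_against_Lp:
  assumes "sigma_finite_measure M" and pq: "1 < p" "1 / p + 1 / q = 1"
    and [measurable]: "u \<in> borel_measurable M" and u: "\<And>x. 0 \<le> u x"
    and fin: "\<And>f. f \<in> Lp M p \<Longrightarrow> (\<And>x. 0 \<le> f x) \<Longrightarrow> (\<integral>\<^sup>+x. ennreal (f x * u x) \<partial>M) < \<infinity>"
  shows "u \<in> Lp M q"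
proof (rule ccontr)
  interpret sigma_finite_measure M by fact
  have q: "1 < q"
    using conjugate_exponent_gt_1 pq by blast
  define w where "w x = ennreal (u x powr q)" for x
  have [measurable]: "w \<in> borel_measurable M"
    unfolding w_def by measurable
  assume "u \<notin> Lp M q"
  then have w_inf: "(\<integral>\<^sup>+x. w x \<partial>M) = \<infinity>"
    using u by (force simp: Lp_def w_def less_top intro!: integrableI_nonneg)
  obtain S :: "nat \<Rightarrow> 'a set" where S: "range S \<subseteq> sets M" "(\<Union>i. S i) = space M"
      "\<And>i. emeasure M (S i) \<noteq> \<infinity>" "incseq S"
    by (rule sigma_finite_incseq) blast
  have [measurable]: "S i \<in> sets M" for i
    using S(1) by auto
  \<comment> \<open>Finite measure together with bounded \<open>u\<close> makes each
    \<open>I n\<close> finite, while the sets exhaust the space, so the \<open>I n\<close> have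
    supremum \<open>\<infinity>\<close>.\<close>
  define E where "E n = S n \<inter> {x\<in>space M. u x \<le> real n}" for n
  have [measurable]: "E n \<in> sets M" for n
    unfolding E_def by measurable
  define I where "I n = (\<integral>\<^sup>+x. w x * indicator (E n) x \<partial>M)" for n
  have I_fin: "I n < \<infinity>" for n
  proof -
    have "I n \<le> (\<integral>\<^sup>+x. ennreal (real n powr q) * indicator (S n) x \<partial>M)"
      unfolding I_def w_def using u q
      by (intro nn_integral_mono) (auto simp: E_def indicator_def intro!: ennreal_leI powr_mono2)
    also have "\<dots> = ennreal (real n powr q) * emeasure M (S n)"
      by (simp add: nn_integral_cmult_indicator)
    also have "\<dots> < \<infinity>"
      using S(3)[of n] by (simp add: ennreal_mult_less_top less_top)
    finally show ?thesis .
  qed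
  have E_mono: "incseq E"
    using S(4) unfolding E_def incseq_def by fastforce
  have "(SUP n. I n) = (\<integral>\<^sup>+x. (SUP n. w x * indicator (E n) x) \<partial>M)"
    unfolding I_def
  proof (rule nn_integral_monotone_convergence_SUP[symmetric])
    show "incseq (\<lambda>n x. w x * indicator (E n) x)"
      using E_mono by (auto simp: incseq_def le_fun_def indicator_def)
  qed measurable
  also have "\<dots> = (\<integral>\<^sup>+x. w x \<partial>M)"
  proof (rule nn_integral_cong)
    fix x assume x: "x \<in> space M"
    obtain i where i: "x \<in> S i"
      using x S(2) by blast
    obtain m :: nat where m: "u x \<le> real m"
      using real_arch_simple by blast
    have "x \<in> S (max i m)"
      using i S(4) by (meson incseqD max.cobounded1 subsetD)
    then have "x \<in> E (max i m)"
      using x m by (auto simp: E_def)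
    then have "w x \<le> (SUP n. w x * indicator (E n) x)"
      by (intro SUP_upper2[of "max i m"]) auto
    moreover have "(SUP n. w x * indicator (E n) x) \<le> w x"
      by (intro SUP_least) (auto simp: indicator_def)
    ultimately show "(SUP n. w x * indicator (E n) x) = w x"
      by (rule antisym[rotated])
  qed
  finally have "(SUP n. I n) = \<infinity>"
    using w_inf by simp
  \<comment> \<open>The threshold gives \<open>J j powr (1 / q) \<ge> 2 ^ j\<close>, which outweighs
    the factor \<open>2 ^ j\<close> that makes the series \<open>G\<close> summable.\<close>
  then have "\<exists>n. ennreal ((2 ^ j) powr q) < I n" for j :: nat
    using less_SUP_iff[of "ennreal ((2 ^ j) powr q)" I UNIV] by simp
  then obtain m where m: "\<And>j. ennreal ((2 ^ j) powr q) < I (m j)"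
    by metis
  define J where "J j = enn2real (I (m j))" for j
  have IJ: "I (m j) = ennreal (J j)" for j
    using I_fin[of "m j"] by (simp add: J_def)
  have J: "(2 ^ j) powr q \<le> J j" for j
    using m[of j] by (simp add: IJ ennreal_less_iff)
  have J_pos: "0 < J j" for j
    using J[of j] by (smt (verit) powr_gt_zero zero_less_power)
  \<comment> \<open>Normalised truncations of \<open>u\<^sup>q\<^sup>-\<^sup>1\<close>, superposed at the level of \<open>p\<close>-th powers.\<close>
  define G where "G x = (\<Sum>j. ennreal (1 / (2 ^ j * J j)) * (w x * indicator (E (m j)) x))" for x
  have [measurable]: "G \<in> borel_measurable M"
    unfolding G_def by measurable
  have "(\<integral>\<^sup>+x. G x \<partial>M) = (\<Sum>j. ennreal (1 / (2 ^ j * J j)) * I (m j))"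
    unfolding G_def I_def by (simp add: nn_integral_suminf nn_integral_cmult)
  also have "\<dots> = (\<Sum>j. ennreal ((1 / 2) ^ j))"
    using J_pos by (intro suminf_cong) (simp add: IJ ennreal_mult[symmetric] power_one_over less_imp_le less_imp_neq[THEN not_sym])
  also have "\<dots> = ennreal (\<Sum>j. (1 / 2) ^ j)"
    by (intro suminf_ennreal2) auto
  finally have G_int: "(\<integral>\<^sup>+x. G x \<partial>M) < \<infinity>"
    by simp
  define f where "f x = enn2real (G x) powr (1 / p)" for x
  have [measurable]: "f \<in> borel_measurable M"
    unfolding f_def by measurable
  have "integrable M (\<lambda>x. enn2real (G x))"
  proof (rule integrableI_nonneg)
    have "(\<integral>\<^sup>+x. ennreal (enn2real (G x)) \<partial>M) \<le> (\<integral>\<^sup>+x. G x \<partial>M)"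
      by (intro nn_integral_mono) (simp add: ennreal_enn2real_if)
    then show "(\<integral>\<^sup>+x. ennreal (enn2real (G x)) \<partial>M) < \<infinity>"
      using G_int by (rule order_le_less_trans)
  qed auto
  then have "f \<in> Lp M p"
    using pq(1) by (simp add: Lp_def f_def powr_powr)
  then have "(\<integral>\<^sup>+x. ennreal (f x * u x) \<partial>M) < \<infinity>"
    by (rule fin) (simp add: f_def)
  then obtain R where R: "0 \<le> R" "(\<integral>\<^sup>+x. ennreal (f x * u x) \<partial>M) = ennreal R"
    by (cases "\<integral>\<^sup>+x. ennreal (f x * u x) \<partial>M") auto
  have G_fin: "AE x in M. G x \<noteq> \<infinity>"
    using G_int by (intro nn_integral_PInf_AE) auto
  \<comment> \<open>One summand of \<open>G\<close> suffices: on \<open>E (m j)\<close> it yields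
    \<open>f \<ge> a * u powr (q / p)\<close>, and multiplying by \<open>u\<close> gives
    \<open>u powr q\<close> because \<open>q / p + 1 = q\<close>.\<close>
  have "(2 ^ j) powr (1 / q) \<le> R" for j :: nat
  proof -
    define a where "a = (1 / (2 ^ j * J j)) powr (1 / p)"
    have "AE x in M. ennreal a * (w x * indicator (E (m j)) x) \<le> ennreal (f x * u x)"
      using G_fin
    proof eventually_elim
      case (elim x)
      show ?case
      proof (cases "x \<in> E (m j)")
        case True
        have "ennreal (1 / (2 ^ j * J j)) * (w x * indicator (E (m j)) x) \<le> G x"
          unfolding G_def
          using sum_le_suminf[OF summableI, of "{j}" "\<lambda>j. ennreal (1 / (2 ^ j * J j)) * (w x * indicator (E (m j)) x)"]
          by simp
        moreover have "ennreal (1 / (2 ^ j * J j)) * (w x * indicator (E (m j)) x)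
            = ennreal (1 / (2 ^ j * J j) * u x powr q)"
          using True J_pos[of j] by (subst ennreal_mult) (simp_all add: w_def)
        ultimately have "ennreal (1 / (2 ^ j * J j) * u x powr q) \<le> G x"
          by simp
        also have "G x = ennreal (enn2real (G x))"
          using elim by (simp add: less_top)
        finally have "1 / (2 ^ j * J j) * u x powr q \<le> enn2real (G x)"
          by (simp add: ennreal_le_iff)
        then have "(1 / (2 ^ j * J j) * u x powr q) powr (1 / p) \<le> f x"
          unfolding f_def using J_pos[of j] pq by (intro powr_mono2) auto
        then have "a * u x powr (q / p) \<le> f x"
          using J_pos[of j] u[of x] by (simp add: a_def powr_mult powr_powr powr_divide)
        then have "a * u x powr (q / p) * u x \<le> f x * u x"
          using u by (intro mult_right_mono)
        moreover have "u x powr (q / p) * u x = u x powr q"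
          using u[of x] powr_add[of "u x" "q / p" 1] conjugate_exponent_eq(2)[OF pq] by simp
        ultimately have "a * u x powr q \<le> f x * u x"
          by (simp add: mult.assoc)
        then show ?thesis
          using True by (simp add: w_def a_def ennreal_leI flip: ennreal_mult)
      qed simp
    qed
    then have "(\<integral>\<^sup>+x. ennreal a * (w x * indicator (E (m j)) x) \<partial>M) \<le> ennreal R"
      unfolding R(2)[symmetric] by (rule nn_integral_mono_AE)
    then have "ennreal a * ennreal (J j) \<le> ennreal R"
      by (simp add: nn_integral_cmult I_def[symmetric] IJ)
    then have "a * J j \<le> R"
      using J_pos[of j] R(1) by (simp add: a_def flip: ennreal_mult)
    moreover have "(2 ^ j) powr (1 / q) \<le> a * J j"
      unfolding a_def using pq J[of j] by (intro powr_conjugate_le) auto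
    ultimately show ?thesis
      by simp
  qed
  moreover have "1 < 2 powr (1 / q)"
    using q by simp
  then obtain j where "R < (2 powr (1 / q)) ^ j"
    using real_arch_pow by blast
  moreover have "(2 powr (1 / q)) ^ j = (2 ^ j) powr (1 / q)"
    by (simp add: powr_realpow[symmetric] powr_powr ac_simps)
  ultimately show False
    by (metis not_le)
qed

text \<open>Test with \<open>sgn (u - v)\<close> times a strictly positive function \<open>a\<close>
  in \<open>Lp M p\<close>: the integral of \<open>a * \<bar>u - v\<bar>\<close> is then 0.\<close>

lemma Lp_eq_AE_if_same_pairing:
  assumes "sigma_finite_measure M" and pq: "1 < p" "1 / p + 1 / q = 1"
    and u: "u \<in> Lp M q" "v \<in> Lp M q"
    and eq: "\<And>f. f \<in> Lp M p \<Longrightarrow> (\<integral>x. f x * u x \<partial>M) = (\<integral>x. f x * v x \<partial>M)"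
  shows "AE x in M. u x = v x"
proof -
  obtain a where a: "a \<in> Lp M p" "\<forall>x\<in>space M. 0 < a x"
    using exists_positive_Lp[OF assms(1), of p] pq(1) by auto
  have [measurable]: "u \<in> borel_measurable M" "v \<in> borel_measurable M" "a \<in> borel_measurable M"
    using u a(1) by (auto simp: Lp_def)
  define f where "f x = sgn (u x - v x) * a x" for x
  have "f \<in> borel_measurable M"
    unfolding f_def by measurable
  then have f: "f \<in> Lp M p"
    using a(1) pq(1) by (rule_tac Lp_bounded_by[of a]) (auto simp: f_def abs_mult abs_sgn_eq)
  note int = integrable_mult_Lp[OF pq f u(1)] integrable_mult_Lp[OF pq f u(2)]
  have "(\<integral>x. f x * u x - f x * v x \<partial>M) = 0"
    using int eq[OF f] by simp
  moreover have "f x * u x - f x * v x = a x * \<bar>u x - v x\<bar>" for x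
    by (simp add: f_def abs_sgn algebra_simps)
  ultimately have "(\<integral>x. a x * \<bar>u x - v x\<bar> \<partial>M) = 0" "integrable M (\<lambda>x. a x * \<bar>u x - v x\<bar>)"
    using Bochner_Integration.integrable_diff[OF int] by simp_all
  then have "AE x in M. a x * \<bar>u x - v x\<bar> = 0"
    using a(2) by (subst (asm) integral_nonneg_eq_0_iff_AE) (auto simp: less_imp_le)
  then show ?thesis
    using AE_space by eventually_elim (use a(2) in force)
qed

section \<open>Monotone approximation and the extension of positive operators\<close>

text \<open>Cut off both the domain and the values. Existence of such a sequence keeps the condition
  in \<open>pos_extension\<close> from being vacuous.\<close>

lemma exists_Lp_approx:
  assumes "sigma_finite_measure M" "0 < p" and [measurable]: "f \<in> borel_measurable M"
  shows "\<exists>F. Lp_approx M p F f"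
proof -
  interpret sigma_finite_measure M by fact
  obtain S :: "nat \<Rightarrow> 'a set" where S: "range S \<subseteq> sets M" "(\<Union>i. S i) = space M"
      "\<And>i. emeasure M (S i) \<noteq> \<infinity>" "incseq S"
    by (rule sigma_finite_incseq) blast
  have [measurable]: "S i \<in> sets M" for i
    using S(1) by auto
  \<comment> \<open>The minimum is taken before \<open>enn2real\<close>, which would send
    \<open>\<infinity>\<close> to 0.\<close>
  define F where "F n x = indicator (S n) x * enn2real (min (f x) (of_nat n))" for n x
  have [measurable]: "F n \<in> borel_measurable M" for n
    unfolding F_def by measurable
  have min_fin: "min (f x) (of_nat n) < top" for n x
    by (simp add: min_less_iff_disj of_nat_less_top)
  have F_le: "F n x \<le> n" for n x
  proof -
    have "enn2real (min (f x) (of_nat n)) \<le> n"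
      by (rule enn2real_leI) (auto simp: ennreal_of_nat_eq_real_of_nat)
    then show ?thesis
      by (simp add: F_def indicator_def)
  qed
  have F_nonneg: "0 \<le> F n x" for n x
    by (simp add: F_def)
  have "F n \<in> Lp M p" for n
  proof -
    have "integrable M (\<lambda>x. \<bar>F n x\<bar> powr p)"
    proof (rule integrableI_bounded_set[of "S n" _ _ "real n powr p"])
      show "AE x in M. x \<in> S n \<longrightarrow> norm (\<bar>F n x\<bar> powr p) \<le> real n powr p"
        using F_le F_nonneg \<open>0 < p\<close> by (intro AE_I2) (auto intro!: powr_mono2)
    qed (use S(3) in \<open>auto simp: F_def less_top\<close>)
    then show ?thesis
      by (simp add: Lp_def)
  qed
  moreover have "incseq (\<lambda>n. F n x)" for x
  proof (rule incseq_SucI)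
    fix n
    have "enn2real (min (f x) (of_nat n)) \<le> enn2real (min (f x) (of_nat (Suc n)))"
      using min_fin[of x "Suc n"] by (intro enn2real_mono min.mono of_nat_mono) auto
    moreover have "x \<in> S n \<Longrightarrow> x \<in> S (Suc n)"
      using S(4) by (auto simp: incseq_Suc_iff)
    ultimately show "F n x \<le> F (Suc n) x"
      by (auto simp: F_def indicator_def)
  qed
  moreover have "(\<lambda>n. ennreal (F n x)) \<longlonglongrightarrow> f x" if x: "x \<in> space M" for x
  proof -
    obtain i where i: "x \<in> S i"
      using x S(2) by blast
    have "eventually (\<lambda>n. ennreal (F n x) = min (f x) (of_nat n)) sequentially"
      using eventually_ge_at_top[of i]
    proof eventually_elim
      case (elim n)
      then have "x \<in> S n"
        using i S(4) by (meson incseqD subsetD)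
      then show ?case
        using min_fin[of x n] by (simp add: F_def)
    qed
    moreover have "(\<lambda>n. min (f x) (of_nat n)) \<longlonglongrightarrow> min (f x) top"
      by (intro tendsto_min tendsto_const of_nat_tendsto_top_ennreal)
    ultimately show ?thesis
      by (simp add: tendsto_cong)
  qed
  ultimately have "Lp_approx M p F f"
    unfolding Lp_approx_def using F_nonneg by auto
  then show ?thesis
    by blast
qed

text \<open>Monotone convergence; the limit is the same for all approximating sequences.\<close>

lemma kernel_int_Lp_approx:
  assumes [measurable]: "k y \<in> borel_measurable M" "f \<in> borel_measurable M" and F: "Lp_approx M p F f"
  shows "(\<lambda>n. kernel_int M k (\<lambda>x. ennreal (F n x)) y) \<longlonglongrightarrow> kernel_int M k f y"
proof -
  have [measurable]: "F n \<in> borel_measurable M" for n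
    using F by (auto simp: Lp_approx_def Lp_def)
  have AE: "AE x in M. incseq (\<lambda>n. F n x) \<and> (\<lambda>n. ennreal (F n x)) \<longlonglongrightarrow> f x"
    using F by (simp add: Lp_approx_def)
  have mono: "AE x in M. k y x * ennreal (F n x) \<le> k y x * ennreal (F (Suc n) x)" for n
    using AE by eventually_elim (auto simp: incseq_Suc_iff intro!: mult_left_mono ennreal_leI)
  have "kernel_int M k f y = (\<integral>\<^sup>+x. (SUP n. k y x * ennreal (F n x)) \<partial>M)"
    unfolding kernel_int_def
  proof (rule nn_integral_cong_AE)
    show "AE x in M. k y x * f x = (SUP n. k y x * ennreal (F n x))"
      using AE
    proof eventually_elim
      case (elim x)
      then have "incseq (\<lambda>n. ennreal (F n x))"
        by (auto simp: incseq_def intro!: ennreal_leI)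
      then have "f x = (SUP n. ennreal (F n x))"
        using elim LIMSEQ_SUP LIMSEQ_unique by blast
      then show ?case
        by (simp add: SUP_mult_left_ennreal)
    qed
  qed
  also have "\<dots> = (SUP n. kernel_int M k (\<lambda>x. ennreal (F n x)) y)"
    unfolding kernel_int_def by (rule nn_integral_monotone_convergence_SUP_AE) (use mono in auto)
  also have "(\<lambda>n. kernel_int M k (\<lambda>x. ennreal (F n x)) y) \<longlonglongrightarrow> \<dots>"
    unfolding kernel_int_def using mono by (intro LIMSEQ_SUP incseq_SucI nn_integral_mono_AE)
  finally show ?thesis .
qed

text \<open>The kernel integral satisfies the condition under \<open>SOME\<close>. Any function
  satisfying it has the same limits along one approximating sequence, hence agrees with the kernel
  integral a.e.\<close>

lemma pos_extension_kernel:
  assumes "sigma_finite_measure M" "0 < p"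
    and [measurable]: "(\<lambda>(y, x). k y x) \<in> borel_measurable (N \<Otimes>\<^sub>M M)" "f \<in> borel_measurable M"
    and S: "\<And>F. F \<in> Lp M p \<Longrightarrow> AE x in M. 0 \<le> F x \<Longrightarrow>
      AE y in N. ennreal (S F y) = kernel_int M k (\<lambda>x. ennreal (F x)) y"
  shows "pos_extension M N p S f \<in> borel_measurable N"
    and "AE y in N. pos_extension M N p S f y = kernel_int M k f y"
proof -
  have lim: "AE y in N. (\<lambda>n. ennreal (S (F n) y)) \<longlonglongrightarrow> kernel_int M k f y" if F: "Lp_approx M p F f" for F
  proof -
    have "AE y in N. \<forall>n. ennreal (S (F n) y) = kernel_int M k (\<lambda>x. ennreal (F n x)) y"
      using F by (intro AE_all_countable[THEN iffD2] allI S) (auto simp: Lp_approx_def)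
    then show ?thesis
      using AE_space
    proof eventually_elim
      case (elim y)
      then show ?case
        using kernel_int_Lp_approx[of k y M f p F] kernel_section_measurable[OF assms(3) elim(2)] assms(4) F
        by simp
    qed
  qed
  have "pos_extension M N p S f \<in> borel_measurable N \<and>
      (\<forall>F. Lp_approx M p F f \<longrightarrow> (AE y in N. (\<lambda>n. ennreal (S (F n) y)) \<longlonglongrightarrow> pos_extension M N p S f y))"
    unfolding pos_extension_def
    by (rule someI[of _ "kernel_int M k f"]) (use lim assms in auto)
  then have *: "pos_extension M N p S f \<in> borel_measurable N"
    "\<And>F. Lp_approx M p F f \<Longrightarrow> AE y in N. (\<lambda>n. ennreal (S (F n) y)) \<longlonglongrightarrow> pos_extension M N p S f y"
    by auto
  then show "pos_extension M N p S f \<in> borel_measurable N"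
    by simp
  obtain F where F: "Lp_approx M p F f"
    using exists_Lp_approx[OF assms(1,2,4)] by blast
  show "AE y in N. pos_extension M N p S f y = kernel_int M k f y"
    using *(2)[OF F] lim[OF F] by eventually_elim (rule LIMSEQ_unique)
qed

subsection \<open>Kernel operators on Lebesgue spaces\<close>

locale Lp_kernel_operator = M: sigma_finite_measure M + N: sigma_finite_measure N
  for M :: "'a measure" and N :: "'b measure" +
  fixes p q :: real and T :: "('a \<Rightarrow> real) \<Rightarrow> 'b \<Rightarrow> real" and k :: "'b \<times> 'a \<Rightarrow> real"
  assumes pq: "1 < p" "1 / p + 1 / q = 1"
    and k_measurable [measurable]: "k \<in> borel_measurable (N \<Otimes>\<^sub>M M)"
    and k_pos: "\<And>y x. y \<in> space N \<Longrightarrow> x \<in> space M \<Longrightarrow> 0 < k (y, x)"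
    and T_Lp: "\<And>f. f \<in> Lp M p \<Longrightarrow> T f \<in> Lp N p"
    and T_eq: "\<And>f. f \<in> Lp M p \<Longrightarrow>
      AE y in N. integrable M (\<lambda>x. k (y, x) * f x) \<and> T f y = (\<integral>x. k (y, x) * f x \<partial>M)"
begin

abbreviation \<kappa> :: "'b \<Rightarrow> 'a \<Rightarrow> ennreal" where
  "\<kappa> y x \<equiv> ennreal (k (y, x))"

abbreviation "\<kappa>' \<equiv> \<lambda>x y. \<kappa> y x"

lemma \<kappa>_measurable [measurable]: "(\<lambda>(y, x). \<kappa> y x) \<in> borel_measurable (N \<Otimes>\<^sub>M M)"
  by measurable

lemma q_gt_1: "1 < q"
  using conjugate_exponent_gt_1[OF pq] .

text \<open>The integrability in \<open>T_eq\<close> allows the Bochner integral to be read as an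
  integral in \<open>[0,\<infinity>]\<close>, the setting of the preceding sections.\<close>

lemma T_eq_kernel_int:
  assumes "f \<in> Lp M p" "AE x in M. 0 \<le> f x"
  shows "AE y in N. 0 \<le> T f y \<and> ennreal (T f y) = kernel_int M \<kappa> (\<lambda>x. ennreal (f x)) y"
  using T_eq[OF assms(1)] AE_space
proof eventually_elim
  case (elim y)
  have nonneg: "AE x in M. 0 \<le> k (y, x) * f x"
    using assms(2) AE_space
    by eventually_elim (use k_pos[OF elim(2)] in \<open>simp add: less_imp_le\<close>)
  have "ennreal (T f y) = (\<integral>\<^sup>+x. ennreal (k (y, x) * f x) \<partial>M)"
    using elim(1) nonneg by (simp add: nn_integral_eq_integral)
  also have "\<dots> = kernel_int M \<kappa> (\<lambda>x. ennreal (f x)) y"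
    unfolding kernel_int_def
  proof (rule nn_integral_cong_AE)
    show "AE x in M. ennreal (k (y, x) * f x) = \<kappa> y x * ennreal (f x)"
      using assms(2) AE_space
      by eventually_elim (use k_pos[OF elim(2)] in \<open>auto simp: ennreal_mult less_imp_le\<close>)
  qed
  finally show ?case
    using elim(1) nonneg by (simp add: integral_nonneg_AE)
qed

lemma T_diff:
  assumes "f \<in> Lp M p" "g \<in> Lp M p" "(\<lambda>x. f x - g x) \<in> Lp M p"
  shows "AE y in N. T (\<lambda>x. f x - g x) y = T f y - T g y"
  using T_eq[OF assms(1)] T_eq[OF assms(2)] T_eq[OF assms(3)]
  by eventually_elim (simp add: right_diff_distrib)

text \<open>Tonelli's theorem, with Hoelder's inequality ensuring that the common value is finite.
  This finiteness feeds the converse of Hoelder's inequality.\<close>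

lemma kernel_int_pairing:
  assumes f: "f \<in> Lp M p" "AE x in M. 0 \<le> f x" and g: "g \<in> Lp N q" "AE y in N. 0 \<le> g y"
  shows "(\<integral>\<^sup>+x. ennreal (f x) * kernel_int N \<kappa>' (\<lambda>y. ennreal (g y)) x \<partial>M) = ennreal (\<integral>y. T f y * g y \<partial>N)"
proof -
  have [measurable]: "f \<in> borel_measurable M" "g \<in> borel_measurable N"
    using f g by (auto simp: Lp_def)
  have "(\<integral>\<^sup>+x. ennreal (f x) * kernel_int N \<kappa>' (\<lambda>y. ennreal (g y)) x \<partial>M)
      = (\<integral>\<^sup>+y. ennreal (g y) * kernel_int M \<kappa> (\<lambda>x. ennreal (f x)) y \<partial>N)"
    using M.sigma_finite_measure_axioms N.sigma_finite_measure_axioms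
    by (intro kernel_int_transpose[symmetric]) measurable
  also have "\<dots> = (\<integral>\<^sup>+y. ennreal (T f y * g y) \<partial>N)"
  proof (rule nn_integral_cong_AE)
    show "AE y in N. ennreal (g y) * kernel_int M \<kappa> (\<lambda>x. ennreal (f x)) y = ennreal (T f y * g y)"
      using T_eq_kernel_int[OF f] g(2) by eventually_elim (metis ennreal_mult mult.commute)
  qed
  also have "\<dots> = ennreal (\<integral>y. T f y * g y \<partial>N)"
  proof (rule nn_integral_eq_integral)
    show "integrable N (\<lambda>y. T f y * g y)"
      using pq T_Lp[OF f(1)] g(1) by (rule integrable_mult_Lp)
    show "AE y in N. 0 \<le> T f y * g y"
      using T_eq_kernel_int[OF f] g(2) by eventually_elim simp
  qed
  finally show ?thesis .
qed

text \<open>The transposed kernel integral \<open>U\<close> is finite a.e., its real version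
  \<open>u\<close> lies in \<open>Lp M q\<close> and satisfies the duality relation. So
  \<open>u\<close> is an admissible choice for the adjoint, and admissible choices agree
  a.e.\<close>

lemma adjoint_eq_kernel_int:
  assumes g: "g \<in> Lp N q" "AE y in N. 0 \<le> g y"
  shows "AE x in M. ennreal (Lp_adjoint M N p q T g x) = kernel_int N \<kappa>' (\<lambda>y. ennreal (g y)) x"
proof -
  have [measurable]: "g \<in> borel_measurable N"
    using g by (auto simp: Lp_def)
  define U where "U = kernel_int N \<kappa>' (\<lambda>y. ennreal (g y))"
  have [measurable]: "U \<in> borel_measurable M"
    unfolding U_def using N.sigma_finite_measure_axioms by measurable
  define u where "u x = enn2real (U x)" for x
  have [measurable]: "u \<in> borel_measurable M"
    unfolding u_def by measurable
  obtain a where a: "a \<in> Lp M p" "\<forall>x\<in>space M. 0 < a x"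
    using exists_positive_Lp[of M p] pq(1) M.sigma_finite_measure_axioms by auto
  \<comment> \<open>Pair \<open>U\<close> with a strictly positive function: a finite integral of
    \<open>a * U\<close> makes \<open>U\<close> finite a.e.\<close>
  have U_fin: "AE x in M. U x < \<infinity>"
  proof -
    have [measurable]: "a \<in> borel_measurable M"
      using a by (auto simp: Lp_def)
    have "(\<integral>\<^sup>+x. ennreal (a x) * U x \<partial>M) \<noteq> \<infinity>"
      unfolding U_def by (subst kernel_int_pairing[OF a(1) _ g]) (use a(2) in \<open>auto intro!: AE_I2 less_imp_le\<close>)
    then have "AE x in M. ennreal (a x) * U x \<noteq> \<infinity>"
      by (intro nn_integral_PInf_AE) auto
    then show ?thesis
      using AE_space by eventually_elim (use a(2) in \<open>auto simp: ennreal_mult_eq_top_iff less_top\<close>)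
  qed
  have nn: "(\<integral>\<^sup>+x. ennreal (f x * u x) \<partial>M) = ennreal (\<integral>y. T f y * g y \<partial>N)"
    if f: "f \<in> Lp M p" "\<And>x. 0 \<le> f x" for f
  proof -
    have "(\<integral>\<^sup>+x. ennreal (f x * u x) \<partial>M) = (\<integral>\<^sup>+x. ennreal (f x) * U x \<partial>M)"
    proof (rule nn_integral_cong_AE)
      show "AE x in M. ennreal (f x * u x) = ennreal (f x) * U x"
        using U_fin by eventually_elim (simp add: u_def ennreal_mult f)
    qed
    then show ?thesis
      unfolding U_def using kernel_int_pairing[OF f(1) _ g] f(2) by simp
  qed
  have u: "u \<in> Lp M q"
    by (rule Lp_of_integrable_against_Lp[OF M.sigma_finite_measure_axioms pq])
      (auto simp: nn, auto simp: u_def)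
  have nonneg: "(\<integral>x. f x * u x \<partial>M) = (\<integral>y. T f y * g y \<partial>N)"
    if f: "f \<in> Lp M p" "\<And>x. 0 \<le> f x" for f
  proof -
    have "ennreal (\<integral>x. f x * u x \<partial>M) = (\<integral>\<^sup>+x. ennreal (f x * u x) \<partial>M)"
      by (rule nn_integral_eq_integral[symmetric]) (use integrable_mult_Lp[OF pq f(1) u] f in \<open>auto simp: u_def\<close>)
    also have "\<dots> = ennreal (\<integral>y. T f y * g y \<partial>N)"
      by (rule nn[OF f])
    finally show ?thesis
    \<comment> \<open>\<open>ennreal\<close> is injective only on nonnegative reals, so the signs of
      both integrals have to be checked.\<close>
    proof (rule ennreal_inj[THEN iffD1, rotated 2])
      show "0 \<le> (\<integral>x. f x * u x \<partial>M)"
        using f by (intro Bochner_Integration.integral_nonneg) (auto simp: u_def)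
      have "AE y in N. 0 \<le> T f y * g y"
        using T_eq_kernel_int[OF f(1)] g(2) f(2) by (auto elim!: eventually_elim2)
      then show "0 \<le> (\<integral>y. T f y * g y \<partial>N)"
        by (rule integral_nonneg_AE)
    qed
  qed
  have dual: "(\<integral>x. f x * u x \<partial>M) = (\<integral>y. T f y * g y \<partial>N)" if f: "f \<in> Lp M p" for f
  proof -
    define f1 where "f1 x = max (f x) 0" for x
    define f2 where "f2 x = max (- f x) 0" for x
    have [measurable]: "f \<in> borel_measurable M"
      using f by (auto simp: Lp_def)
    have [measurable]: "f1 \<in> borel_measurable M" "f2 \<in> borel_measurable M"
      unfolding f1_def f2_def by measurable
    have f1: "f1 \<in> Lp M p" and f2: "f2 \<in> Lp M p"
      using pq(1) by (auto intro!: Lp_bounded_by[OF f] simp: f1_def f2_def)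
    have f_eq: "f = (\<lambda>x. f1 x - f2 x)"
      by (auto simp: f1_def f2_def max_def)
    have "(\<integral>x. f x * u x \<partial>M) = (\<integral>x. f1 x * u x \<partial>M) - (\<integral>x. f2 x * u x \<partial>M)"
      using integrable_mult_Lp[OF pq f1 u] integrable_mult_Lp[OF pq f2 u]
      by (subst f_eq) (simp add: left_diff_distrib)
    also have "\<dots> = (\<integral>y. T f1 y * g y \<partial>N) - (\<integral>y. T f2 y * g y \<partial>N)"
      using nonneg[OF f1] nonneg[OF f2] by (simp add: f1_def f2_def)
    also have "\<dots> = (\<integral>y. T f1 y * g y - T f2 y * g y \<partial>N)"
      using integrable_mult_Lp[OF pq T_Lp[OF f1] g(1)] integrable_mult_Lp[OF pq T_Lp[OF f2] g(1)] by simp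
    also have "\<dots> = (\<integral>y. T f y * g y \<partial>N)"
    proof (rule integral_cong_AE)
      show "AE y in N. T f1 y * g y - T f2 y * g y = T f y * g y"
        using T_diff[OF f1 f2] f unfolding f_eq[symmetric]
        by (auto elim: eventually_mono simp: left_diff_distrib)
    qed (use T_Lp[OF f] T_Lp[OF f1] T_Lp[OF f2] in \<open>auto simp: Lp_def\<close>)
    finally show ?thesis .
  qed
  have "Lp_adjoint M N p q T g \<in> Lp M q \<and>
      (\<forall>f\<in>Lp M p. (\<integral>x. f x * Lp_adjoint M N p q T g x \<partial>M) = (\<integral>y. T f y * g y \<partial>N))"
    unfolding Lp_adjoint_def by (rule someI[of _ u]) (use u dual in auto)
  then have "AE x in M. Lp_adjoint M N p q T g x = u x"
    using u dual by (intro Lp_eq_AE_if_same_pairing[OF M.sigma_finite_measure_axioms pq]) auto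
  then show ?thesis
    using U_fin unfolding U_def[symmetric] by eventually_elim (simp add: u_def)
qed

section \<open>The nonlinear operator of \<open>T\<close> and minimising sequences\<close>

text \<open>As \<open>(p - 1) * q = p\<close>, the power lands in the domain of the adjoint.\<close>

lemma T_powr_Lp:
  assumes "f \<in> Lp M p" "AE x in M. 0 \<le> f x"
  shows "(\<lambda>y. T f y powr (p - 1)) \<in> Lp N q"
proof -
  have Tf [measurable]: "T f \<in> borel_measurable N" and int: "integrable N (\<lambda>y. \<bar>T f y\<bar> powr p)"
    using T_Lp[OF assms(1)] by (auto simp: Lp_def)
  have "\<bar>T f y powr (p - 1)\<bar> powr q = \<bar>T f y\<bar> powr p" if "0 \<le> T f y" for y
    using that conjugate_exponent_eq(1)[OF pq] by (simp add: powr_powr)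
  then have "AE y in N. \<bar>T f y powr (p - 1)\<bar> powr q = \<bar>T f y\<bar> powr p"
    using T_eq_kernel_int[OF assms] by (auto elim: eventually_mono)
  then have "integrable N (\<lambda>y. \<bar>T f y powr (p - 1)\<bar> powr q) \<longleftrightarrow> integrable N (\<lambda>y. \<bar>T f y\<bar> powr p)"
    by (intro integrable_cong_AE) auto
  then show ?thesis
    using int by (simp add: Lp_def)
qed

text \<open>Turns the inequality defining \<open>lambda_op\<close> into one for
  \<open>nonlinear_int\<close>.\<close>

lemma adjoint_T_powr_eq_nonlinear_int:
  assumes "f \<in> Lp M p" "AE x in M. 0 \<le> f x"
  shows "AE x in M. ennreal (Lp_adjoint M N p q T (\<lambda>y. T f y powr (p - 1)) x)
    = nonlinear_int M N \<kappa> (p - 1) (\<lambda>x. ennreal (f x)) x"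
proof -
  have "AE y in N. ennreal (T f y powr (p - 1)) = ennreal_powr (kernel_int M \<kappa> (\<lambda>x. ennreal (f x)) y) (p - 1)"
    using T_eq_kernel_int[OF assms] by eventually_elim (metis ennreal_powr_ennreal)
  then have "kernel_int N \<kappa>' (\<lambda>y. ennreal (T f y powr (p - 1))) x
      = nonlinear_int M N \<kappa> (p - 1) (\<lambda>x. ennreal (f x)) x" for x
    unfolding nonlinear_int_def by (rule kernel_int_cong_AE)
  then show ?thesis
    using adjoint_eq_kernel_int[OF T_powr_Lp[OF assms]] by simp
qed

text \<open>The kernel form of the extension is used twice: for \<open>T\<close>, and then for the
  adjoint with \<open>M\<close> and \<open>N\<close> exchanged, exponent \<open>q\<close> and the
  transposed kernel.\<close>

lemma pos_extension_eq_nonlinear_int: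
  assumes [measurable]: "h \<in> borel_measurable M"
  shows "AE x in M. pos_extension N M q (Lp_adjoint M N p q T)
      (\<lambda>y. ennreal_powr (pos_extension M N p T h y) (p - 1)) x = nonlinear_int M N \<kappa> (p - 1) h x"
proof -
  have T: "AE y in N. ennreal (T F y) = kernel_int M \<kappa> (\<lambda>x. ennreal (F x)) y"
    if "F \<in> Lp M p" "AE x in M. 0 \<le> F x" for F
    using T_eq_kernel_int[OF that] by (auto elim: eventually_mono)
  note ext = pos_extension_kernel[OF M.sigma_finite_measure_axioms _ \<kappa>_measurable assms T]
  have [measurable]: "pos_extension M N p T h \<in> borel_measurable N"
    using pq(1) by (intro ext) auto
  have "AE y in N. pos_extension M N p T h y = kernel_int M \<kappa> h y"
    using pq(1) by (intro ext) auto
  then have "AE y in N. ennreal_powr (pos_extension M N p T h y) (p - 1) = ennreal_powr (kernel_int M \<kappa> h y) (p - 1)"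
    by (auto elim: eventually_mono)
  then have "kernel_int N \<kappa>' (\<lambda>y. ennreal_powr (pos_extension M N p T h y) (p - 1)) x
      = nonlinear_int M N \<kappa> (p - 1) h x" for x
    unfolding nonlinear_int_def by (rule kernel_int_cong_AE)
  moreover have "AE x in M. pos_extension N M q (Lp_adjoint M N p q T)
      (\<lambda>y. ennreal_powr (pos_extension M N p T h y) (p - 1)) x
      = kernel_int N \<kappa>' (\<lambda>y. ennreal_powr (pos_extension M N p T h y) (p - 1)) x"
    using q_gt_1
    by (intro pos_extension_kernel adjoint_eq_kernel_int kernel_swap_measurable[OF \<kappa>_measurable])
      (auto intro: N.sigma_finite_measure_axioms)
  ultimately show ?thesis
    by simp
qed

lemma exists_positive_supersolution:
  "\<exists>h. h \<in> borel_measurable M \<and> (AE x in M. 0 < h x) \<and>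
    (AE x in M. pos_extension N M q (Lp_adjoint M N p q T)
        (\<lambda>y. ennreal_powr (pos_extension M N p T (\<lambda>x. ennreal (h x)) y) (p - 1)) x
      \<le> lambda_op M N p q T * ennreal (h x powr (p - 1)))"
proof (cases "lambda_op M N p q T = \<infinity>")
  \<comment> \<open>With \<open>h = 1\<close> the right-hand side is
    \<open>\<infinity>\<close>.\<close>
  case True
  then show ?thesis
    by (intro exI[of _ "\<lambda>_. 1"]) simp
next
  case False
  define L where "L = lambda_op M N p q T"
  have L: "L < \<infinity>"
    using False by (simp add: L_def less_top)
  define Q where "Q n c f \<longleftrightarrow> 0 \<le> c \<and> ennreal c < L + ennreal (1 / Suc n) \<and> L \<le> ennreal c \<and>
      f \<in> Lp M p \<and> (AE x in M. 0 < f x) \<and>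
      (AE x in M. Lp_adjoint M N p q T (\<lambda>y. T f y powr (p - 1)) x \<le> c * f x powr (p - 1))" for n c f
  have "\<exists>c f. Q n c f" for n
  proof -
    \<comment> \<open>Strict because \<open>L\<close> is finite; the definition of the infimum then
      supplies a nearly optimal constant.\<close>
    have "L < L + ennreal (1 / Suc n)"
      using L by (cases L) (simp_all add: ennreal_less_iff flip: ennreal_plus)
    then obtain C where C: "C < L + ennreal (1 / Suc n)" "C \<in> {ennreal c | c. 0 \<le> c \<and>
       (\<exists>f\<in>Lp M p. (AE x in M. 0 < f x) \<and>
          (AE x in M. Lp_adjoint M N p q T (\<lambda>y. T f y powr (p - 1)) x \<le> c * f x powr (p - 1)))}"
      unfolding L_def lambda_op_def by (subst (asm) Inf_less_iff) blast
    moreover from C(2) have "L \<le> C"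
      unfolding L_def lambda_op_def by (rule Inf_lower)
    ultimately show ?thesis
      unfolding Q_def by blast
  qed
  then obtain c f where "\<And>n. Q n (c n) (f n)"
    by metis
  then have c: "\<And>n. (0::real) \<le> c n" "\<And>n. ennreal (c n) < L + ennreal (1 / Suc n)" "\<And>n. L \<le> ennreal (c n)"
    and f: "\<And>n. f n \<in> Lp M p" "\<And>n. AE x in M. 0 < f n x"
    and le: "\<And>n. AE x in M. Lp_adjoint M N p q T (\<lambda>y. T (f n) y powr (p - 1)) x \<le> c n * f n x powr (p - 1)"
    by (simp_all add: Q_def)
  have f_nonneg: "AE x in M. 0 \<le> f n x" for n
    using f(2)[of n] by eventually_elim simp
  have [measurable]: "f n \<in> borel_measurable M" for n
    using f(1)[of n] by (simp add: Lp_def)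
  have "\<exists>h\<in>borel_measurable M. (AE x in M. 0 < h x \<and> h x < \<infinity>) \<and>
      (AE x in M. nonlinear_int M N \<kappa> (p - 1) h x \<le> L * ennreal_powr (h x) (p - 1))"
  proof (rule exists_nonlinear_int_supersolution[OF M.sigma_finite_measure_axioms N.sigma_finite_measure_axioms,
        where f = "\<lambda>n x. ennreal (f n x)" and c = "\<lambda>n. ennreal (c n)"])
    show "AE x in M. 0 < ennreal (f n x)" for n
      using f(2)[of n] by simp
    show "(\<integral>\<^sup>+x. ennreal (f n x) * indicator A x \<partial>M) < \<infinity>" if [measurable]: "A \<in> sets M" and A: "emeasure M A < \<infinity>" for n A
    proof -
      \<comment> \<open>A set of finite measure has its indicator in \<open>Lp M q\<close>, so
        Hoelder's inequality bounds the integral over it.\<close>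
      have "(\<lambda>x. indicator A x) \<in> Lp M q"
      proof -
        have "\<bar>indicator A x\<bar> powr q = (indicator A x :: real)" for x
          by (simp add: indicator_def)
        then show ?thesis
          using A by (simp add: Lp_def)
      qed
      then have "integrable M (\<lambda>x. f n x * indicator A x)"
        using pq f(1) integrable_mult_Lp by blast
      then have "(\<integral>\<^sup>+x. ennreal (norm (f n x * indicator A x)) \<partial>M) < \<infinity>"
        by (simp add: integrable_iff_bounded)
      moreover have "(\<integral>\<^sup>+x. ennreal (f n x) * indicator A x \<partial>M) \<le> (\<integral>\<^sup>+x. ennreal (norm (f n x * indicator A x)) \<partial>M)"
        by (intro nn_integral_mono) (auto simp: indicator_def intro!: ennreal_leI)
      ultimately show ?thesis
        by (rule order_le_less_trans[rotated])
    qed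
    show "AE x in M. nonlinear_int M N \<kappa> (p - 1) (\<lambda>x. ennreal (f n x)) x
        \<le> ennreal (c n) * ennreal_powr (ennreal (f n x)) (p - 1)" for n
      using adjoint_T_powr_eq_nonlinear_int[OF f(1)[of n] f_nonneg[of n]] le[of n] f_nonneg[of n]
    proof eventually_elim
      case (elim x)
      then show ?case
        using c(1)[of n] ennreal_leI[OF elim(2)] unfolding elim(1)
        by (simp add: ennreal_powr_ennreal flip: ennreal_mult)
    qed
    show "(\<lambda>n. ennreal (c n)) \<longlonglongrightarrow> L"
    proof (rule tendsto_sandwich[where f = "\<lambda>_. L" and h = "\<lambda>n. L + ennreal (1 / Suc n)"])
      have "(\<lambda>n. ennreal (1 / Suc n)) \<longlonglongrightarrow> ennreal 0"
        using LIMSEQ_inverse_real_of_nat by (intro tendsto_ennrealI) (auto simp: inverse_eq_divide)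
      then have "(\<lambda>n. L + ennreal (1 / Suc n)) \<longlonglongrightarrow> L + ennreal 0"
        by (intro tendsto_add tendsto_const)
      then show "(\<lambda>n. L + ennreal (1 / Suc n)) \<longlonglongrightarrow> L"
        by simp
    qed (use c in \<open>auto intro!: always_eventually less_imp_le\<close>)
  qed (use pq(1) k_pos L in auto)
  then obtain h where [measurable]: "h \<in> borel_measurable M" and h: "AE x in M. 0 < h x \<and> h x < \<infinity>"
    and h_le: "AE x in M. nonlinear_int M N \<kappa> (p - 1) h x \<le> L * ennreal_powr (h x) (p - 1)"
    by blast
  have pos: "AE x in M. 0 < enn2real (h x)"
    using h by eventually_elim (auto simp: enn2real_positive_iff)
  have h_eq: "AE x in M. ennreal (enn2real (h x)) = h x"
    using h by eventually_elim auto
  \<comment> \<open>The inner integral sees \<open>h\<close> only up to null sets, so passing to the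
    real-valued version changes the nonlinear integral at no point at all.\<close>
  have "nonlinear_int M N \<kappa> (p - 1) (\<lambda>x. ennreal (enn2real (h x))) = nonlinear_int M N \<kappa> (p - 1) h"
    unfolding nonlinear_int_def kernel_int_cong_AE[OF h_eq, of \<kappa>] ..
  then have "AE x in M. pos_extension N M q (Lp_adjoint M N p q T)
        (\<lambda>y. ennreal_powr (pos_extension M N p T (\<lambda>x. ennreal (enn2real (h x))) y) (p - 1)) x
      \<le> L * ennreal (enn2real (h x) powr (p - 1))"
    using pos_extension_eq_nonlinear_int[of "\<lambda>x. ennreal (enn2real (h x))"] h_le h
    by (auto simp: ennreal_powr_def elim!: eventually_elim2)
  then show ?thesis
    using pos unfolding L_def by (intro exI[of _ "\<lambda>x. enn2real (h x)"]) auto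
qed

end

theorem theoremA1:
  fixes M :: "'a measure" and N :: "'b measure" and p q :: real
    and T :: "('a \<Rightarrow> real) \<Rightarrow> ('b \<Rightarrow> real)"
  assumes "sigma_finite_measure M" and "sigma_finite_measure N"
    and "1 < p" and "1 / p + 1 / q = 1"
    and "positive_kernel_operator M N p T"
  shows "\<exists>h :: 'a \<Rightarrow> real. h \<in> borel_measurable M \<and> (AE x in M. 0 < h x) \<and>
    (AE x in M.
       pos_extension N M q (Lp_adjoint M N p q T)
         (\<lambda>y. ennreal_powr (pos_extension M N p T (\<lambda>x. ennreal (h x)) y) (p - 1)) x
       \<le> lambda_op M N p q T * ennreal (h x powr (p - 1)))"
proof -
  obtain k where "k \<in> borel_measurable (N \<Otimes>\<^sub>M M)" "\<forall>y\<in>space N. \<forall>x\<in>space M. 0 < k (y, x)"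
    "\<forall>f\<in>Lp M p. AE y in N. integrable M (\<lambda>x. k (y, x) * f x) \<and> T f y = (\<integral>x. k (y, x) * f x \<partial>M)"
    using assms(5) by (auto simp: positive_kernel_operator_def)
  then have "Lp_kernel_operator M N p q T k"
    using assms
    by (auto simp: Lp_kernel_operator_def Lp_kernel_operator_axioms_def positive_kernel_operator_def Lp_linear_def)
  then show ?thesis
    by (rule Lp_kernel_operator.exists_positive_supersolution)
qed

end
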